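(* Let $n\in\mathbb{N}$, let $B_n^+$ be the braid monoid on $n$ strands with set of atoms $\mathcal{A}=\{\sigma_1,\ldots,\sigma_{n-1}\}$, and let $\mathfrak{T}$ be the finite state automaton recognising normal forms whose set of states is the power set $\mathcal{P}(\mathcal{A})$ (described in the context). If $X,Y\subseteq\mathcal{A}$ and $Y\neq\emptyset$, then the number of transitions from the state $X$ of $\mathfrak{T}$ to an accept state $Y'$ of $\mathfrak{T}$ with $Y\subseteq Y'$ (counted over all such $Y'$) is $N_{\deg(Y),\deg(\mathcal{A}\setminus X)}$.
   Context: $B_n^+$ is the monoid with generators $\sigma_1,\ldots,\sigma_{n-1}$ and relations $\sigma_i\sigma_{i+1}\sigma_i=\sigma_{i+1}\sigma_i\sigma_{i+1}$ for $1\le i\le n-2$ and $\sigma_i\sigma_j=\sigma_j\sigma_i$ for $|i-j|\ge2$. For $x,y\in B_n^+$ write $x\preccurlyeq y$ if $xc=y$ for some $c\in B_n^+$, and $x\succcurlyeq y$ if $x=cy$ for some $c\in B_n^+$. The Garside element $\Delta$ is the $\preccurlyeq$-least common multiple of the atoms (equal to the $\succcurlyeq$-least common multiple of the atoms), and $D=\{s\mid s\preccurlyeq\Delta\}=\{s\mid\Delta\succcurlyeq s\}$ is the finite set of simple elements. The starting set and finishing set of $x$ are $S(x)=\{a\in\mathcal{A}\mid a\preccurlyeq x\}$ and $F(x)=\{a\in\mathcal{A}\mid x\succcurlyeq a\}$. The canonical map $\pi:D\to\mathfrak{S}_n$ (sending a simple element to the permutation $\pi_s$ it induces on the $n$ strands,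 with $\pi(\sigma_i)$ the transposition $(i\ \ i+1)$) is a bijection; for $s\in D$ one has $\sigma_i\preccurlyeq s$ iff $\pi_s(i)>\pi_s(i+1)$, and $s\succcurlyeq\sigma_i$ iff $\pi_s^{-1}(i)>\pi_s^{-1}(i+1)$. The automaton $\mathfrak{T}$ has state set $\mathcal{P}(\mathcal{A})$, alphabet $D$, initial state $\mathcal{A}$, accept states $\mathcal{P}(\mathcal{A})\setminus\{\emptyset\}$, and transition function $(X,s)\mapsto F(s)$ if $S(s)\subseteq X$ and $(X,s)\mapsto\emptyset$ otherwise. Each letter $s\in D$ gives one transition from each state. For $Z\subseteq\mathcal{A}$, the orbits on $\{1,\ldots,n\}$ of the subgroup $\langle\pi(Z)\rangle\le\mathfrak{S}_n$ generated by $\{\pi(a)\mid a\in Z\}$ are sets of consecutive integers; if $O_1,\ldots,O_r$ are these orbits in their natural (left to right) order, then $\deg(Z)=[|O_1|,\ldots,|O_r|]$. For finite sequences $A=[a_1,\ldots,a_r]$, $B=[b_1,\ldots,b_s]$ of non-negative integers with equal sums, $N_{A,B}$ is the number of simple vertex-labelled bipartite graphs $(U,V,E)$, $U=\{u_1,\ldots,u_r\}$, $V=\{v_1,\ldots,v_s\}$, $E\subseteq U\times V$, with $\deg(u_i)=a_i$ and $\deg(v_j)=b_j$ for all $i,j$. *)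

theory Defs
  imports "HOL-Algebra.Divisibility" "HOL-Algebra.Sym_Groups" "HOL-Algebra.Group_Action"
    "HOL-Algebra.Generated_Groups"
begin

section \<open>Presented monoids and positive braid monoids\<close>

inductive_set word_cong :: "'a set \<Rightarrow> ('a list \<times> 'a list) set \<Rightarrow> ('a list \<times> 'a list) set"
  for A :: "'a set" and R :: "('a list \<times> 'a list) set"
  where
    refl: "w \<in> lists A \<Longrightarrow> (w, w) \<in> word_cong A R"
  | sym: "(u, v) \<in> word_cong A R \<Longrightarrow> (v, u) \<in> word_cong A R"
  | trans: "(u, v) \<in> word_cong A R \<Longrightarrow> (v, w) \<in> word_cong A R \<Longrightarrow> (u, w) \<in> word_cong A R"
  | rel: "(u, v) \<in> R \<Longrightarrow> u \<in> lists A \<Longrightarrow> v \<in> lists A \<Longrightarrow> p \<in> lists A \<Longrightarrow> q \<in> lists A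
      \<Longrightarrow> (p @ u @ q, p @ v @ q) \<in> word_cong A R"

definition presented_monoid :: "'a set \<Rightarrow> ('a list \<times> 'a list) set \<Rightarrow> 'a list set monoid"
  where "presented_monoid A R =
    \<lparr> carrier = lists A // word_cong A R,
      mult = (\<lambda>x y. \<Union>u\<in>x. \<Union>v\<in>y. word_cong A R `` {u @ v}),
      one = word_cong A R `` {[]} \<rparr>"

text \<open>The letter \<open>i\<close> stands for the generator \<open>\<sigma>\<^sub>i\<close>, with \<open>1 \<le> i < n\<close>.\<close>

definition braid_relations :: "nat \<Rightarrow> (nat list \<times> nat list) set"
  where "braid_relations n =
    {([i, i + 1, i], [i + 1, i, i + 1]) | i. 1 \<le> i \<and> i + 2 \<le> n} \<union>
    {([i, j], [j, i]) | i j. i \<in> {1..<n} \<and> j \<in> {1..<n} \<and> \<bar>int i - int j\<bar> \<ge> 2}"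

definition braid_monoid :: "nat \<Rightarrow> nat list set monoid"
  where "braid_monoid n = presented_monoid {1..<n} (braid_relations n)"

definition braid_gen :: "nat \<Rightarrow> nat \<Rightarrow> nat list set"
  where "braid_gen n i = word_cong {1..<n} (braid_relations n) `` {[i]}"

definition atoms :: "nat \<Rightarrow> nat list set set"
  where "atoms n = braid_gen n ` {1..<n}"

section \<open>Divisibility, the Garside element, simple elements\<close>

text \<open>
  The library's \<open>x divides y\<close>, that is, \<open>y = x \<otimes> c\<close> for some \<open>c\<close>, is divisibility
  on the left, i.e. \<open>x \<preceq> y\<close>. The relation \<open>y \<succeq> x\<close> is the following one.
\<close>

definition right_divides :: "('a, 'b) monoid_scheme \<Rightarrow> 'a \<Rightarrow> 'a \<Rightarrow> bool"
  where "right_divides G x y \<longleftrightarrow> (\<exists>c\<in>carrier G. y = c \<otimes>\<^bsub>G\<^esub> x)"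

definition is_left_lcm :: "('a, 'b) monoid_scheme \<Rightarrow> 'a set \<Rightarrow> 'a \<Rightarrow> bool"
  where "is_left_lcm G A d \<longleftrightarrow>
    d \<in> carrier G \<and> (\<forall>a\<in>A. a divides\<^bsub>G\<^esub> d) \<and>
    (\<forall>m\<in>carrier G. (\<forall>a\<in>A. a divides\<^bsub>G\<^esub> m) \<longrightarrow> d divides\<^bsub>G\<^esub> m)"

definition garside :: "nat \<Rightarrow> nat list set"
  where "garside n = (THE d. is_left_lcm (braid_monoid n) (atoms n) d)"

definition simples :: "nat \<Rightarrow> nat list set set"
  where "simples n = {s \<in> carrier (braid_monoid n). s divides\<^bsub>braid_monoid n\<^esub> garside n}"

definition starting_set :: "nat \<Rightarrow> nat list set \<Rightarrow> nat list set set"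
  where "starting_set n x = {a \<in> atoms n. a divides\<^bsub>braid_monoid n\<^esub> x}"

definition finishing_set :: "nat \<Rightarrow> nat list set \<Rightarrow> nat list set set"
  where "finishing_set n x = {a \<in> atoms n. right_divides (braid_monoid n) a x}"

section \<open>The automaton recognising normal forms\<close>

record ('q, 'a) automaton =
  states :: "'q set"
  alphabet :: "'a set"
  initial :: 'q
  accepting :: "'q set"
  trans_fun :: "'q \<Rightarrow> 'a \<Rightarrow> 'q"

text \<open>
  A transition carries its letter, so distinct letters give distinct transitions even
  when source and target agree.
\<close>

definition transitions :: "('q, 'a) automaton \<Rightarrow> ('q \<times> 'a \<times> 'q) set"
  where "transitions M =
    {(p, s, q). p \<in> states M \<and> s \<in> alphabet M \<and> q = trans_fun M p s}"

definition normal_form_automaton :: "nat \<Rightarrow> (nat list set set, nat list set) automaton"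
  where "normal_form_automaton n =
    \<lparr> states = Pow (atoms n),
      alphabet = simples n,
      initial = atoms n,
      accepting = Pow (atoms n) - {{}},
      trans_fun = (\<lambda>X s. if starting_set n s \<subseteq> X then finishing_set n s else {}) \<rparr>"

section \<open>Induced permutations and the degree sequence of a set of atoms\<close>

text \<open>
  Words act on strand positions from left to right (the leftmost letter first), so that
  \<open>\<sigma>\<^sub>i \<preceq> s\<close> corresponds to a descent of the permutation of \<open>s\<close> at \<open>i\<close>.
\<close>

definition word_perm :: "nat list \<Rightarrow> nat \<Rightarrow> nat"
  where "word_perm w = fold (\<lambda>i p. transpose i (i + 1) \<circ> p) w id"

text \<open>All words representing the same braid induce the same permutation.\<close>

definition braid_perm :: "nat list set \<Rightarrow> nat \<Rightarrow> nat"
  where "braid_perm x = the_elem (word_perm ` x)"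

definition strand_orbits :: "nat \<Rightarrow> nat list set set \<Rightarrow> nat set set"
  where "strand_orbits n Z =
    orbits ((sym_group n)\<lparr>carrier := generate (sym_group n) (braid_perm ` Z)\<rparr>) {1..n} (\<lambda>p. p)"

text \<open>The orbits are disjoint sets of consecutive integers: ordering them from left to
  right means ordering them by their minima.\<close>

definition deg_seq :: "nat \<Rightarrow> nat list set set \<Rightarrow> nat list"
  where "deg_seq n Z = map card (sorted_key_list_of_set Min (strand_orbits n Z))"

section \<open>Counting labelled bipartite graphs with given degrees\<close>

text \<open>
  With vertices \<open>u\<^sub>i\<close> (\<open>i < length A\<close>) and \<open>v\<^sub>j\<close> (\<open>j < length B\<close>), indexed from 0, the pair
  \<open>(i, j)\<close> stands for the edge joining \<open>u\<^sub>i\<close> and \<open>v\<^sub>j\<close>.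
\<close>

definition bipartite_graphs :: "nat list \<Rightarrow> nat list \<Rightarrow> (nat \<times> nat) set set"
  where "bipartite_graphs A B =
    {E. E \<subseteq> {..<length A} \<times> {..<length B} \<and>
        (\<forall>i<length A. card {j. (i, j) \<in> E} = A ! i) \<and>
        (\<forall>j<length B. card {i. (i, j) \<in> E} = B ! j)}"

definition num_bipartite :: "nat list \<Rightarrow> nat list \<Rightarrow> nat"
  where "num_bipartite A B = card (bipartite_graphs A B)"

end

theory Submission
  imports Defs
begin

text \<open>
  Left divisibility of positive braids is controlled by Garside's key lemma: an equation
  \<open>i x = j y\<close> forces both sides to factor through the least common multiple of the generators
  \<open>i\<close> and \<open>j\<close>. With Matsumoto's theorem this identifies the Garside element with the braid of the
  order-reversing permutation and its divisors with the reduced words of permutations, so that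
  starting and finishing sets of simple elements become the descents of a permutation and of its
  inverse. The transitions to be counted then correspond to the permutations \<open>p\<close> that increase on the
  orbits of \<open>\<A> \ X\<close> and whose inverse decreases on the orbits of \<open>Y\<close>. Such a \<open>p\<close> sends at most one
  point of each orbit of \<open>\<A> \ X\<close> into each orbit of \<open>Y\<close>; joining two orbits when this happens
  gives a bipartite graph with the required degrees, and \<open>p\<close> is recovered from the graph by
  monotonicity.
\<close>

section \<open>Braid words\<close>

text \<open>The monoid is given by its presentation alone, and the Garside element as a least common
  multiple, so cancellation and the existence of that multiple must be extracted from the relations.
  These preserve length, which makes induction on words possible and division antisymmetric. The
  complement of X enters because S(s) contained in X forbids descents outside X, that is, demands
  ascents at the indices of the remaining atoms. Ascents of p and descents of its inverse oppose
  each other: two points of one orbit of the complement sent into one orbit of Y would have to keep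
  their order and also exchange it. This is why the graph is simple. Conversely, the edges of a
  graph serve as an intermediate set. Sorted upwards within columns they enumerate the arguments of
  p, sorted downwards within rows they enumerate its values, and p matches the two enumerations. The
  count is carried out for arbitrary monotone functions \<open>f\<close> and \<open>g\<close> in
  place of the two numberings of orbits.\<close>

abbreviation braid_words :: "nat \<Rightarrow> nat list set"
  where "braid_words n \<equiv> lists {1..<n}"

abbreviation braid_eq :: "nat list \<Rightarrow> nat \<Rightarrow> nat list \<Rightarrow> bool"  ("(_ \<simeq>\<^bsub>_\<^esub> _)" [51, 0, 51] 50)
  where "u \<simeq>\<^bsub>n\<^esub> v \<equiv> (u, v) \<in> word_cong {1..<n} (braid_relations n)"

lemma word_cong_in_lists:
  assumes "(u, v) \<in> word_cong A R"
  shows "u \<in> lists A" and "v \<in> lists A"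
  using assms by (induction) auto

lemma equiv_word_cong: "equiv (lists A) (word_cong A R)"
proof (rule equivI)
  show "word_cong A R \<subseteq> lists A \<times> lists A"
    using word_cong_in_lists by fast
  show "refl_on (lists A) (word_cong A R)"
    by (auto simp: refl_on_def intro: word_cong.refl dest: word_cong_in_lists)
  show "sym (word_cong A R)" by (auto intro: symI word_cong.sym)
  show "trans (word_cong A R)" by (blast intro: transI word_cong.trans)
qed

text \<open>Only the rule \<open>rel\<close> carries a context. Enlarging that context, and passing
  through the other rules, makes the congruence compatible with concatenation.\<close>

lemma word_cong_context:
  assumes "(u, v) \<in> word_cong A R" and "p \<in> lists A" and "q \<in> lists A"
  shows "(p @ u @ q, p @ v @ q) \<in> word_cong A R"
  using assms
proof (induction)
  case (rel u v p' q')
  then have "((p @ p') @ u @ (q' @ q), (p @ p') @ v @ (q' @ q)) \<in> word_cong A R"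
    by (intro word_cong.rel) auto
  then show ?case by simp
next
  case (trans u v w)
  then show ?case by (blast intro: word_cong.trans)
qed (auto intro: word_cong.sym intro!: word_cong.refl)

lemma word_cong_append:
  assumes "(u, u') \<in> word_cong A R" and "(v, v') \<in> word_cong A R"
  shows "(u @ v, u' @ v') \<in> word_cong A R"
proof -
  have "(u @ v, u' @ v) \<in> word_cong A R"
    using word_cong_context[OF assms(1), of "[]" v] word_cong_in_lists[OF assms(2)] by simp
  moreover have "(u' @ v, u' @ v') \<in> word_cong A R"
    using word_cong_context[OF assms(2), of u' "[]"] word_cong_in_lists[OF assms(1)] by simp
  ultimately show ?thesis by (rule word_cong.trans)
qed

lemma word_cong_Cons:
  "(u, v) \<in> word_cong A R \<Longrightarrow> a \<in> A \<Longrightarrow> (a # u, a # v) \<in> word_cong A R"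
  using word_cong_context[of u v A R "[a]" "[]"] by simp

lemmas braid_eq_trans [trans] = word_cong.trans[where A = "{1..<n}" and R = "braid_relations n" for n]

definition adjacent :: "nat \<Rightarrow> nat \<Rightarrow> bool"
  where "adjacent i j \<longleftrightarrow> j = i + 1 \<or> i = j + 1"

lemma adjacent_sym: "adjacent i j \<longleftrightarrow> adjacent j i"
  by (auto simp: adjacent_def)

lemma braid_eq_far:
  assumes "i \<noteq> j" "\<not> adjacent i j" "i \<in> {1..<n}" "j \<in> {1..<n}" "q \<in> braid_words n"
  shows "i # j # q \<simeq>\<^bsub>n\<^esub> j # i # q"
proof -
  have "([i, j], [j, i]) \<in> braid_relations n"
    using assms by (auto simp: braid_relations_def adjacent_def)
  then show ?thesis
    using word_cong.rel[of "[i, j]" "[j, i]" "braid_relations n" "{1..<n}" "[]" q] assms by simp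
qed

lemma braid_eq_adj:
  assumes "adjacent i j" "i \<in> {1..<n}" "j \<in> {1..<n}" "q \<in> braid_words n"
  shows "i # j # i # q \<simeq>\<^bsub>n\<^esub> j # i # j # q"
proof -
  have up: "k # (k+1) # k # q \<simeq>\<^bsub>n\<^esub> (k+1) # k # (k+1) # q" if "k \<in> {1..<n}" "k + 1 \<in> {1..<n}" for k
  proof -
    have "([k, k+1, k], [k+1, k, k+1]) \<in> braid_relations n"
      using that by (auto simp: braid_relations_def)
    then show ?thesis
      using word_cong.rel[of "[k, k+1, k]" "[k+1, k, k+1]" "braid_relations n" "{1..<n}" "[]" q]
        that assms by simp
  qed
  from assms(1) consider "j = i + 1" | "i = j + 1" by (auto simp: adjacent_def)
  then show ?thesis
    using up[of i] word_cong.sym[OF up[of j]] assms by cases auto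
qed

text \<open>Isolates the two kinds of relation for later inductions. One orientation of the braid
  relation suffices, because symmetry is a case of its own.\<close>

lemma braid_eq_induct [consumes 1, case_names refl sym trans adj far]:
  assumes "u \<simeq>\<^bsub>n\<^esub> v"
    and "\<And>w. w \<in> braid_words n \<Longrightarrow> P w w"
    and "\<And>u v. u \<simeq>\<^bsub>n\<^esub> v \<Longrightarrow> P u v \<Longrightarrow> P v u"
    and "\<And>u v w. u \<simeq>\<^bsub>n\<^esub> v \<Longrightarrow> P u v \<Longrightarrow> v \<simeq>\<^bsub>n\<^esub> w \<Longrightarrow> P v w \<Longrightarrow> P u w"
    and "\<And>i p q. i \<in> {1..<n} \<Longrightarrow> i + 1 \<in> {1..<n} \<Longrightarrow> p \<in> braid_words n \<Longrightarrow> q \<in> braid_words n \<Longrightarrow>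
      P (p @ [i, i + 1, i] @ q) (p @ [i + 1, i, i + 1] @ q)"
    and "\<And>i j p q. i \<in> {1..<n} \<Longrightarrow> j \<in> {1..<n} \<Longrightarrow> i \<noteq> j \<Longrightarrow> \<not> adjacent i j \<Longrightarrow>
      p \<in> braid_words n \<Longrightarrow> q \<in> braid_words n \<Longrightarrow> P (p @ [i, j] @ q) (p @ [j, i] @ q)"
  shows "P u v"
  using assms(1)
proof (induction)
  case (rel u v p q)
  then consider i where "1 \<le> i" "i + 2 \<le> n" "u = [i, i+1, i]" "v = [i+1, i, i+1]"
    | i j where "i \<in> {1..<n}" "j \<in> {1..<n}" "\<bar>int i - int j\<bar> \<ge> 2" "u = [i, j]" "v = [j, i]"
    by (auto simp: braid_relations_def)
  then show ?case
  proof cases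
    case 1
    then show ?thesis using assms(5)[of i p q] rel by simp
  next
    case 2
    then have "i \<noteq> j" "\<not> adjacent i j" by (auto simp: adjacent_def)
    then show ?thesis using assms(6)[of i j p q] 2 rel by simp
  qed
qed (use assms in blast)+

lemma braid_eq_length: "u \<simeq>\<^bsub>n\<^esub> v \<Longrightarrow> length u = length v"
  by (induction rule: braid_eq_induct) auto

text \<open>Reversal permutes the defining relations up to orientation. This symmetry later turns
  statements about first letters into statements about last letters.\<close>

lemma braid_eq_rev: "u \<simeq>\<^bsub>n\<^esub> v \<Longrightarrow> rev u \<simeq>\<^bsub>n\<^esub> rev v"
proof (induction rule: braid_eq_induct)
  case (adj i p q)
  then have "rev q \<in> braid_words n" "rev p \<in> braid_words n" by auto
  then show ?case
    using adj word_cong_context[OF braid_eq_adj[of i "i+1" n "[]"], of "rev q" "rev p"]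
    by (simp add: adjacent_def)
next
  case (far i j p q)
  then have "rev q \<in> braid_words n" "rev p \<in> braid_words n" by auto
  then show ?case
    using far word_cong_context[OF braid_eq_far[of j i n "[]"], of "rev q" "rev p"]
    by (simp add: adjacent_sym)
qed (auto intro: word_cong.intros)

subsection \<open>Cancellation and least common multiples of two generators\<close>

text \<open>The conclusion of Garside's key lemma for \<open>i # x \<simeq> j # y\<close>: both words factor through the least
  common multiple of \<open>i\<close> and \<open>j\<close>. For shorter words the lemma is available by induction on the
  length, which makes the conclusion transitive; it is then preserved along any chain of
  relations.\<close>

definition split_heads :: "nat \<Rightarrow> nat \<Rightarrow> nat list \<Rightarrow> nat \<Rightarrow> nat list \<Rightarrow> bool"
  where "split_heads n i x j y \<longleftrightarrow>
    (if i = j then x \<simeq>\<^bsub>n\<^esub> y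
     else if adjacent i j then \<exists>z. x \<simeq>\<^bsub>n\<^esub> j # i # z \<and> y \<simeq>\<^bsub>n\<^esub> i # j # z
     else \<exists>z. x \<simeq>\<^bsub>n\<^esub> j # z \<and> y \<simeq>\<^bsub>n\<^esub> i # z)"

lemma split_heads_sym: "split_heads n i x j y \<Longrightarrow> split_heads n j y i x"
  by (auto simp: split_heads_def adjacent_sym split: if_splits intro: word_cong.sym)

context
  notes One_nat_def [simp del]
begin

text \<open>If \<open>i\<close> and \<open>j\<close> both differ from \<open>k\<close>, then
  \<open>w\<close> is congruent to a word starting with \<open>i\<close> and to one starting with
  \<open>j\<close>. Since \<open>w\<close> has length \<open>L\<close>, the tails of these words are
  shorter and \<open>IH\<close> applies to them; its witnesses are refined until \<open>x\<close>
  and \<open>y\<close> can be rewritten explicitly. The case names record the pairs ik, kj, ij in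
  this order, with a for adjacent and f for far.\<close>

lemma split_heads_trans:
  assumes IH: "\<And>i x j y. length x < L \<Longrightarrow> i # x \<simeq>\<^bsub>n\<^esub> j # y \<Longrightarrow> split_heads n i x j y"
    and 1: "split_heads n i x k w" and 2: "split_heads n k w j y" and L: "length x = L"
    and g: "i \<in> {1..<n}" "k \<in> {1..<n}" "j \<in> {1..<n}"
  shows "split_heads n i x j y"
proof -
  note [simp] = g[simplified]
  have same: "a \<simeq>\<^bsub>n\<^esub> b" if "i # a \<simeq>\<^bsub>n\<^esub> i # b" "length a < L" for i a b
    using IH[OF that(2,1)] by (simp add: split_heads_def)
  have adj: "\<exists>z. a \<simeq>\<^bsub>n\<^esub> j # i # z \<and> b \<simeq>\<^bsub>n\<^esub> i # j # z"
    if "i # a \<simeq>\<^bsub>n\<^esub> j # b" "length a < L" "adjacent i j" for i a j b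
    using IH[OF that(2,1)] that(3) by (auto simp: split_heads_def adjacent_def)
  have far: "\<exists>z. a \<simeq>\<^bsub>n\<^esub> j # z \<and> b \<simeq>\<^bsub>n\<^esub> i # z"
    if "i # a \<simeq>\<^bsub>n\<^esub> j # b" "length a < L" "i \<noteq> j" "\<not> adjacent i j" for i a j b
    using IH[OF that(2,1)] that(3,4) by (simp add: split_heads_def)
  note S = word_cong.sym and T = word_cong.trans and C = word_cong_Cons
  note words = word_cong_in_lists
  have len: "length a = length b" if "a \<simeq>\<^bsub>n\<^esub> b" for a b using braid_eq_length[OF that] .

  \<comment> \<open>Here \<open>j\<close> commutes with \<open>i\<close> and \<open>k\<close>. The
    letters are quantified afresh because \<open>faf\<close> is the same situation with the chain
    read from \<open>j\<close> to \<open>i\<close>.\<close>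
  have outer_far_inner: "split_heads n i x j y"
    if 1: "split_heads n i x k w" and 2: "split_heads n k w j y"
      and L: "length x = L" and ar: "adjacent i k" "\<not> adjacent k j" "\<not> adjacent i j" "i \<noteq> j" "k \<noteq> j"
      and g: "i \<in> {1..<n}" "k \<in> {1..<n}" "j \<in> {1..<n}"
    for i x k w j y
  proof -
    note [simp] = g[simplified]
    from ar have "i \<noteq> k" by (auto simp: adjacent_def)
    with 1 ar obtain z where z: "x \<simeq>\<^bsub>n\<^esub> k # i # z" "w \<simeq>\<^bsub>n\<^esub> i # k # z"
      by (auto simp: split_heads_def)
    from 2 ar obtain z' where z': "w \<simeq>\<^bsub>n\<^esub> j # z'" "y \<simeq>\<^bsub>n\<^esub> k # z'"
      by (auto simp: split_heads_def)
    from far[OF T[OF S[OF z(2)] z'(1)]] len[OF z(1)] L ar obtain u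
      where u: "k # z \<simeq>\<^bsub>n\<^esub> j # u" "z' \<simeq>\<^bsub>n\<^esub> i # u" by auto
    from far[OF u(1)] len[OF z(1)] L ar obtain v
      where v: "z \<simeq>\<^bsub>n\<^esub> j # v" "u \<simeq>\<^bsub>n\<^esub> k # v" by auto
    have [simp]: "v \<in> braid_words n" using words[OF v(1)] by simp
    note z(1)
    also have "k # i # z \<simeq>\<^bsub>n\<^esub> k # i # j # v" by (intro C v) simp_all
    also have "k # i # j # v \<simeq>\<^bsub>n\<^esub> k # j # i # v"
      using ar by (intro C braid_eq_far) simp_all
    also have "k # j # i # v \<simeq>\<^bsub>n\<^esub> j # k # i # v"
      using ar by (intro C braid_eq_far) simp_all
    finally have x: "x \<simeq>\<^bsub>n\<^esub> j # k # i # v" .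
    note z'(2)
    also have "k # z' \<simeq>\<^bsub>n\<^esub> k # i # u" by (intro C u) simp_all
    also have "k # i # u \<simeq>\<^bsub>n\<^esub> k # i # k # v" by (intro C v) simp_all
    also have "k # i # k # v \<simeq>\<^bsub>n\<^esub> i # k # i # v"
      using ar by (intro C braid_eq_adj) (simp_all add: adjacent_sym)
    finally show ?thesis using x ar by (auto simp: split_heads_def)
  qed

  \<comment> \<open>The letters form the path k - i - j. The rewriting ends in i j i k i j, a word
    for the half twist on four strands and the least common multiple of the three generators. The
    case \<open>faa\<close> is the same chain reversed.\<close>
  have outer_adj: "split_heads n i x j y"
    if 1: "split_heads n i x k w" and 2: "split_heads n k w j y"
      and L: "length x = L" and ar: "adjacent i k" "\<not> adjacent k j" "adjacent i j" "k \<noteq> j"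
      and g: "i \<in> {1..<n}" "k \<in> {1..<n}" "j \<in> {1..<n}"
    for i x k w j y
  proof -
    note [simp] = g[simplified]
    from ar have ne: "i \<noteq> k" "i \<noteq> j" by (auto simp: adjacent_def)
    with 1 ar obtain z where z: "x \<simeq>\<^bsub>n\<^esub> k # i # z" "w \<simeq>\<^bsub>n\<^esub> i # k # z"
      by (auto simp: split_heads_def)
    from 2 ar obtain z' where z': "w \<simeq>\<^bsub>n\<^esub> j # z'" "y \<simeq>\<^bsub>n\<^esub> k # z'"
      by (auto simp: split_heads_def)
    from adj[OF T[OF S[OF z(2)] z'(1)]] len[OF z(1)] L ar obtain u
      where u: "k # z \<simeq>\<^bsub>n\<^esub> j # i # u" "z' \<simeq>\<^bsub>n\<^esub> i # j # u" by auto
    from far[OF u(1)] len[OF z(1)] L ar obtain v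
      where v: "z \<simeq>\<^bsub>n\<^esub> j # v" "i # u \<simeq>\<^bsub>n\<^esub> k # v" by auto
    from adj[OF v(2)] len[OF z(1)] len[OF v(1)] len[OF v(2)] L ar obtain t
      where t: "u \<simeq>\<^bsub>n\<^esub> k # i # t" "v \<simeq>\<^bsub>n\<^esub> i # k # t" by auto
    have [simp]: "t \<in> braid_words n" using words[OF t(1)] by simp
    note z(1)
    also have "k # i # z \<simeq>\<^bsub>n\<^esub> k # i # j # v" by (intro C v) simp_all
    also have "k # i # j # v \<simeq>\<^bsub>n\<^esub> k # i # j # i # k # t" by (intro C t) simp_all
    also have "k # i # j # i # k # t \<simeq>\<^bsub>n\<^esub> k # j # i # j # k # t"
      using ar by (intro C braid_eq_adj) simp_all
    also have "k # j # i # j # k # t \<simeq>\<^bsub>n\<^esub> j # k # i # j # k # t"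
      using ar by (intro C braid_eq_far) simp_all
    also have "j # k # i # j # k # t \<simeq>\<^bsub>n\<^esub> j # k # i # k # j # t"
      using ar by (intro C braid_eq_far) (simp_all add: adjacent_sym)
    also have "j # k # i # k # j # t \<simeq>\<^bsub>n\<^esub> j # i # k # i # j # t"
      using ar by (intro C braid_eq_adj) (simp_all add: adjacent_sym)
    finally have x: "x \<simeq>\<^bsub>n\<^esub> j # i # k # i # j # t" .
    note z'(2)
    also have "k # z' \<simeq>\<^bsub>n\<^esub> k # i # j # u" by (intro C u) simp_all
    also have "k # i # j # u \<simeq>\<^bsub>n\<^esub> k # i # j # k # i # t" by (intro C t) simp_all
    also have "k # i # j # k # i # t \<simeq>\<^bsub>n\<^esub> k # i # k # j # i # t"
      using ar by (intro C braid_eq_far) (simp_all add: adjacent_sym)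
    also have "k # i # k # j # i # t \<simeq>\<^bsub>n\<^esub> i # k # i # j # i # t"
      using ar by (intro C braid_eq_adj) (simp_all add: adjacent_sym)
    also have "i # k # i # j # i # t \<simeq>\<^bsub>n\<^esub> i # k # j # i # j # t"
      using ar by (intro C braid_eq_adj) (simp_all add: adjacent_sym)
    also have "i # k # j # i # j # t \<simeq>\<^bsub>n\<^esub> i # j # k # i # j # t"
      using ar by (intro C braid_eq_far) simp_all
    finally show ?thesis using x ar ne by (auto simp: split_heads_def)
  qed

  have lx: "length x = length w" and lw: "length w = length y"
    using 1 2 by (auto simp: split_heads_def split: if_splits dest!: len)
  \<comment> \<open>Three integers cannot be pairwise adjacent: the diagram of braid relations has
    no triangle, which leaves seven cases with distinct letters.\<close>
  have "\<not> (adjacent i k \<and> adjacent k j \<and> adjacent i j)"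
    unfolding adjacent_def by presburger
  then consider "i = k" | "k = j" | "i = j" "i \<noteq> k"
    | (fff) "i \<noteq> k" "k \<noteq> j" "i \<noteq> j" "\<not> adjacent i k" "\<not> adjacent k j" "\<not> adjacent i j"
    | (aff) "k \<noteq> j" "i \<noteq> j" "adjacent i k" "\<not> adjacent k j" "\<not> adjacent i j"
    | (faf) "i \<noteq> k" "i \<noteq> j" "\<not> adjacent i k" "adjacent k j" "\<not> adjacent i j"
    | (ffa) "i \<noteq> k" "k \<noteq> j" "\<not> adjacent i k" "\<not> adjacent k j" "adjacent i j"
    | (aaf) "i \<noteq> j" "adjacent i k" "adjacent k j" "\<not> adjacent i j"
    | (afa) "k \<noteq> j" "adjacent i k" "\<not> adjacent k j" "adjacent i j"
    | (faa) "i \<noteq> k" "\<not> adjacent i k" "adjacent k j" "adjacent i j"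
    by blast
  then show ?thesis
  proof cases
    case 1
    then show ?thesis
      using \<open>split_heads n i x k w\<close> \<open>split_heads n k w j y\<close>
      unfolding split_heads_def by (metis T)
  next
    case 2
    then show ?thesis
      using \<open>split_heads n i x k w\<close> \<open>split_heads n k w j y\<close>
      unfolding split_heads_def by (metis T S)
  next
    case 3
    show ?thesis
    proof (cases "adjacent i k")
      case True
      with 3 1 2 obtain z z' where z: "x \<simeq>\<^bsub>n\<^esub> k # i # z" "w \<simeq>\<^bsub>n\<^esub> i # k # z"
        and z': "w \<simeq>\<^bsub>n\<^esub> i # k # z'" "y \<simeq>\<^bsub>n\<^esub> k # i # z'"
        by (auto simp: split_heads_def adjacent_sym)
      have "k # z \<simeq>\<^bsub>n\<^esub> k # z'"
        using same[OF T[OF S[OF z(2)] z'(1)]] len[OF z(1)] L by simp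
      then have "z \<simeq>\<^bsub>n\<^esub> z'"
        using same len[OF z(1)] L by simp
      then have "k # i # z \<simeq>\<^bsub>n\<^esub> k # i # z'" by (intro C) simp_all
      then show ?thesis using z z' 3 by (auto simp: split_heads_def intro: T S)
    next
      case False
      with 3 1 2 obtain z z' where z: "x \<simeq>\<^bsub>n\<^esub> k # z" "w \<simeq>\<^bsub>n\<^esub> i # z"
        and z': "w \<simeq>\<^bsub>n\<^esub> i # z'" "y \<simeq>\<^bsub>n\<^esub> k # z'"
        by (auto simp: split_heads_def adjacent_sym)
      have "z \<simeq>\<^bsub>n\<^esub> z'"
        using same[OF T[OF S[OF z(2)] z'(1)]] len[OF z(1)] L by simp
      then have "k # z \<simeq>\<^bsub>n\<^esub> k # z'" by (intro C) simp_all
      then show ?thesis using z z' 3 by (auto simp: split_heads_def intro: T S)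
    qed
  next
    case fff
    with 1 2 obtain z z' where z: "x \<simeq>\<^bsub>n\<^esub> k # z" "w \<simeq>\<^bsub>n\<^esub> i # z"
      and z': "w \<simeq>\<^bsub>n\<^esub> j # z'" "y \<simeq>\<^bsub>n\<^esub> k # z'"
      by (auto simp: split_heads_def)
    from far[OF T[OF S[OF z(2)] z'(1)]] len[OF z(1)] L fff obtain u
      where u: "z \<simeq>\<^bsub>n\<^esub> j # u" "z' \<simeq>\<^bsub>n\<^esub> i # u" by auto
    have [simp]: "u \<in> braid_words n" using words[OF u(1)] by simp
    note z(1)
    also have "k # z \<simeq>\<^bsub>n\<^esub> k # j # u" by (intro C u) simp_all
    also have "k # j # u \<simeq>\<^bsub>n\<^esub> j # k # u" using fff by (intro C braid_eq_far) simp_all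
    finally have x: "x \<simeq>\<^bsub>n\<^esub> j # k # u" .
    note z'(2)
    also have "k # z' \<simeq>\<^bsub>n\<^esub> k # i # u" by (intro C u) simp_all
    also have "k # i # u \<simeq>\<^bsub>n\<^esub> i # k # u"
      using fff by (intro C braid_eq_far) (simp_all add: adjacent_sym)
    finally show ?thesis using x fff by (auto simp: split_heads_def)
  next
    case aff
    then show ?thesis using outer_far_inner[OF 1 2 L] by simp
  next
    case faf
    then show ?thesis
      using outer_far_inner[OF split_heads_sym[OF 2] split_heads_sym[OF 1]] L lx lw
      by (intro split_heads_sym[of n j y i x]) (simp add: adjacent_sym)
  next
    case ffa
    with 1 2 obtain z z' where z: "x \<simeq>\<^bsub>n\<^esub> k # z" "w \<simeq>\<^bsub>n\<^esub> i # z"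
      and z': "w \<simeq>\<^bsub>n\<^esub> j # z'" "y \<simeq>\<^bsub>n\<^esub> k # z'"
      by (auto simp: split_heads_def)
    from adj[OF T[OF S[OF z(2)] z'(1)]] len[OF z(1)] L ffa obtain u
      where u: "z \<simeq>\<^bsub>n\<^esub> j # i # u" "z' \<simeq>\<^bsub>n\<^esub> i # j # u" by auto
    have [simp]: "u \<in> braid_words n" using words[OF u(1)] by simp
    have ne: "i \<noteq> j" using ffa by (auto simp: adjacent_def)
    note z(1)
    also have "k # z \<simeq>\<^bsub>n\<^esub> k # j # i # u" by (intro C u) simp_all
    also have "k # j # i # u \<simeq>\<^bsub>n\<^esub> j # k # i # u" using ffa by (intro C braid_eq_far) simp_all
    also have "j # k # i # u \<simeq>\<^bsub>n\<^esub> j # i # k # u"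
      using ffa by (intro C braid_eq_far) (simp_all add: adjacent_sym)
    finally have x: "x \<simeq>\<^bsub>n\<^esub> j # i # k # u" .
    note z'(2)
    also have "k # z' \<simeq>\<^bsub>n\<^esub> k # i # j # u" by (intro C u) simp_all
    also have "k # i # j # u \<simeq>\<^bsub>n\<^esub> i # k # j # u"
      using ffa by (intro C braid_eq_far) (simp_all add: adjacent_sym)
    also have "i # k # j # u \<simeq>\<^bsub>n\<^esub> i # j # k # u" using ffa by (intro C braid_eq_far) simp_all
    finally show ?thesis using x ffa ne by (auto simp: split_heads_def)
  next
    case aaf
    then have ne: "i \<noteq> k" "k \<noteq> j" by (auto simp: adjacent_def)
    with aaf 1 2 obtain z z' where z: "x \<simeq>\<^bsub>n\<^esub> k # i # z" "w \<simeq>\<^bsub>n\<^esub> i # k # z"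
      and z': "w \<simeq>\<^bsub>n\<^esub> j # k # z'" "y \<simeq>\<^bsub>n\<^esub> k # j # z'"
      by (auto simp: split_heads_def)
    from far[OF T[OF S[OF z(2)] z'(1)]] len[OF z(1)] L aaf obtain u
      where u: "k # z \<simeq>\<^bsub>n\<^esub> j # u" "k # z' \<simeq>\<^bsub>n\<^esub> i # u" by auto
    from adj[OF u(1)] len[OF z(1)] L aaf obtain a
      where a: "z \<simeq>\<^bsub>n\<^esub> j # k # a" "u \<simeq>\<^bsub>n\<^esub> k # j # a" by auto
    from adj[OF u(2)] len[OF z'(1)] len[OF z(2)] len[OF z(1)] L aaf obtain b
      where b: "z' \<simeq>\<^bsub>n\<^esub> i # k # b" "u \<simeq>\<^bsub>n\<^esub> k # i # b" by (auto simp: adjacent_sym)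
    have la: "length a + 4 = L" using len[OF z(1)] len[OF a(1)] L by simp
    \<comment> \<open>Both expressions for \<open>u\<close> start with \<open>k\<close>. Cancelling
      it leaves an equation between words starting with the commuting letters \<open>j\<close> and
      \<open>i\<close>, to which \<open>IH\<close> applies once more.\<close>
    have "j # a \<simeq>\<^bsub>n\<^esub> i # b" using same[OF T[OF S[OF a(2)] b(2)]] la by simp
    from far[OF this] la aaf obtain t
      where t: "a \<simeq>\<^bsub>n\<^esub> i # t" "b \<simeq>\<^bsub>n\<^esub> j # t" by (auto simp: adjacent_sym)
    have [simp]: "t \<in> braid_words n" using words[OF t(1)] by simp
    note z(1)
    also have "k # i # z \<simeq>\<^bsub>n\<^esub> k # i # j # k # a" by (intro C a) simp_all
    also have "k # i # j # k # a \<simeq>\<^bsub>n\<^esub> k # i # j # k # i # t" by (intro C t) simp_all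
    also have "k # i # j # k # i # t \<simeq>\<^bsub>n\<^esub> k # j # i # k # i # t"
      using aaf by (intro C braid_eq_far) simp_all
    also have "k # j # i # k # i # t \<simeq>\<^bsub>n\<^esub> k # j # k # i # k # t"
      using aaf by (intro C braid_eq_adj) simp_all
    also have "k # j # k # i # k # t \<simeq>\<^bsub>n\<^esub> j # k # j # i # k # t"
      using aaf by (intro C braid_eq_adj) simp_all
    finally have x: "x \<simeq>\<^bsub>n\<^esub> j # k # j # i # k # t" .
    note z'(2)
    also have "k # j # z' \<simeq>\<^bsub>n\<^esub> k # j # i # k # b" by (intro C b) simp_all
    also have "k # j # i # k # b \<simeq>\<^bsub>n\<^esub> k # j # i # k # j # t" by (intro C t) simp_all
    also have "k # j # i # k # j # t \<simeq>\<^bsub>n\<^esub> k # i # j # k # j # t"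
      using aaf by (intro C braid_eq_far) (simp_all add: adjacent_sym)
    also have "k # i # j # k # j # t \<simeq>\<^bsub>n\<^esub> k # i # k # j # k # t"
      using aaf by (intro C braid_eq_adj) (simp_all add: adjacent_sym)
    also have "k # i # k # j # k # t \<simeq>\<^bsub>n\<^esub> i # k # i # j # k # t"
      using aaf by (intro C braid_eq_adj) (simp_all add: adjacent_sym)
    also have "i # k # i # j # k # t \<simeq>\<^bsub>n\<^esub> i # k # j # i # k # t"
      using aaf by (intro C braid_eq_far) simp_all
    finally show ?thesis using x aaf by (auto simp: split_heads_def)
  next
    case afa
    then show ?thesis using outer_adj[OF 1 2 L] by simp
  next
    case faa
    then show ?thesis
      using outer_adj[OF split_heads_sym[OF 2] split_heads_sym[OF 1]] L lx lw
      by (intro split_heads_sym[of n j y i x]) (simp add: adjacent_sym)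
  qed
qed

end

text \<open>Two nested inductions: the outer one on length supplies the lemma for shorter words, the
  inner one follows the derivation of the congruence. The outer hypothesis enters only at
  transitivity, through \<open>split_heads_trans\<close>.\<close>

lemma braid_eq_split_heads: "i # x \<simeq>\<^bsub>n\<^esub> j # y \<Longrightarrow> split_heads n i x j y"
proof (induction "length x" arbitrary: i x j y rule: less_induct)
  case less
  \<comment> \<open>\<open>x0\<close> freezes the length bound of the outer induction while the
    words vary in the inner one.\<close>
  have "split_heads n i x j y" if "u \<simeq>\<^bsub>n\<^esub> v" "u = i # x" "v = j # y" "length x = length x0"
      and IH: "\<And>i x j y. length x < length x0 \<Longrightarrow> i # x \<simeq>\<^bsub>n\<^esub> j # y \<Longrightarrow> split_heads n i x j y"
    for u v i x j y and x0 :: "nat list"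
    using that(1-4)
  proof (induction arbitrary: i x j y rule: braid_eq_induct)
    case (refl w)
    then show ?case by (auto simp: split_heads_def intro: word_cong.refl)
  next
    case (sym u v)
    then show ?case using braid_eq_length[OF sym.hyps] by (auto intro: split_heads_sym)
  next
    case (trans u v w)
    from braid_eq_length[OF trans.hyps(1)] trans.prems obtain k z where v: "v = k # z"
      by (cases v) auto
    have "split_heads n i x k z" using trans.IH(1) trans.prems v by simp
    moreover have "split_heads n k z j y"
      using trans.IH(2) trans.prems v braid_eq_length[OF trans.hyps(1)] by simp
    ultimately show ?case
      using split_heads_trans[of "length x0" n i x k z j y] IH trans.prems trans.hyps[THEN word_cong_in_lists(1)]
        trans.hyps[THEN word_cong_in_lists(2)] v by simp
  next
    case (adj a p q)
    show ?case
    proof (cases p)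
      case Nil
      with adj have "i = a" "j = a + 1" "x = (a + 1) # a # q" "y = a # (a + 1) # q" by auto
      then show ?thesis using adj
        by (auto simp: split_heads_def adjacent_def intro!: exI[of _ q] word_cong.refl)
    next
      case (Cons b p')
      with adj have "i = b" "j = b" "x = p' @ [a, a + 1, a] @ q" "y = p' @ [a + 1, a, a + 1] @ q"
        "p' \<in> braid_words n" by auto
      then show ?thesis
        using adj word_cong_context[OF braid_eq_adj[of a "a+1" n "[]"], of p' q]
        by (simp add: split_heads_def adjacent_def)
    qed
  next
    case (far a b p q)
    show ?case
    proof (cases p)
      case Nil
      with far have "i = a" "j = b" "x = b # q" "y = a # q" by auto
      then show ?thesis using far
        by (auto simp: split_heads_def intro!: exI[of _ q] word_cong.refl)
    next
      case (Cons c p')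
      with far have "i = c" "j = c" "x = p' @ [a, b] @ q" "y = p' @ [b, a] @ q"
        "p' \<in> braid_words n" by auto
      then show ?thesis
        using far word_cong_context[OF braid_eq_far[of a b n "[]"], of p' q]
        by (simp add: split_heads_def)
    qed
  qed
  from this[OF less.prems HOL.refl HOL.refl HOL.refl less.hyps] show ?case by blast
qed

lemma braid_eq_Cons_cancel: "i # x \<simeq>\<^bsub>n\<^esub> i # y \<Longrightarrow> x \<simeq>\<^bsub>n\<^esub> y"
  by (drule braid_eq_split_heads) (simp add: split_heads_def)

lemma braid_eq_append_cancel: "p @ x \<simeq>\<^bsub>n\<^esub> p @ y \<Longrightarrow> x \<simeq>\<^bsub>n\<^esub> y"
proof (induction p)
  case (Cons a p)
  then show ?case using braid_eq_Cons_cancel[of a "p @ x" "p @ y" n] by simp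
qed simp

section \<open>Reduced words of permutations\<close>

lemma fold_transpose:
  fixes q :: "nat \<Rightarrow> nat"
  shows "fold (\<lambda>i p. transpose i (i + 1) \<circ> p) w q = word_perm w \<circ> q"
proof (induction w arbitrary: q)
  case (Cons i w)
  let ?f = "\<lambda>i p. transpose i (i + 1) \<circ> p"
  have "word_perm (i # w) = fold ?f w (transpose i (i + 1) \<circ> id)"
    by (simp add: word_perm_def)
  also have "\<dots> = word_perm w \<circ> transpose i (i + 1)"
    by (subst Cons.IH) simp
  finally have "word_perm (i # w) \<circ> q = word_perm w \<circ> (transpose i (i + 1) \<circ> q)"
    by (simp add: comp_assoc)
  also have "\<dots> = fold ?f w (transpose i (i + 1) \<circ> q)"
    by (rule Cons.IH[symmetric])
  also have "\<dots> = fold ?f (i # w) q" by (simp only: fold_simps)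
  finally show ?case by (rule HOL.sym)
qed (simp add: word_perm_def)

lemma word_perm_append: "word_perm (u @ v) = word_perm v \<circ> word_perm u"
proof -
  have "word_perm (u @ v) = fold (\<lambda>i p. transpose i (i + 1) \<circ> p) v (word_perm u)"
    by (simp add: word_perm_def)
  then show ?thesis by (subst (asm) fold_transpose)
qed

lemma word_perm_Nil [simp]: "word_perm [] = id"
  by (simp add: word_perm_def)

lemma word_perm_single [simp]: "word_perm [i] = transpose i (i + 1)"
  by (simp add: word_perm_def)

lemma word_perm_Cons: "word_perm (i # w) = word_perm w \<circ> transpose i (i + 1)"
  using word_perm_append[of "[i]" w] by simp

lemma transpose_Suc_permutes:
  fixes i n :: nat
  shows "i \<in> {1..<n} \<Longrightarrow> transpose i (i + 1) permutes {1..n}"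
  by (rule permutes_swap_id) auto

lemma word_perm_permutes: "w \<in> braid_words n \<Longrightarrow> word_perm w permutes {1..n}"
proof (induction w)
  case (Cons i w)
  then have "i \<in> {1..<n}" "word_perm w permutes {1..n}" by auto
  then show ?case
    unfolding word_perm_Cons by (intro permutes_compose transpose_Suc_permutes)
qed (simp add: permutes_id)

lemma word_perm_rev: "word_perm (rev w) = inv' (word_perm w)"
proof (induction w)
  case (Cons i w)
  have "bij (word_perm w)"
  proof (induction w)
    case (Cons i w)
    then show ?case unfolding word_perm_Cons by (intro bij_comp bij_transpose)
  qed (simp only: word_perm_Nil bij_id)
  then have "inv' (word_perm w \<circ> transpose i (i + 1)) = inv' (transpose i (i + 1)) \<circ> inv' (word_perm w)"
    by (intro o_inv_distrib) auto
  then show ?case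
    by (simp only: rev.simps word_perm_append word_perm_Nil word_perm_Cons id_comp Cons.IH inv_transpose_eq)
qed (simp add: inv_id)

lemma braid_eq_word_perm: "u \<simeq>\<^bsub>n\<^esub> v \<Longrightarrow> word_perm u = word_perm v"
proof (induction rule: braid_eq_induct)
  case (adj i p q)
  have "word_perm [i, i + 1, i] = word_perm [i + 1, i, i + 1]"
    by (rule ext) (simp add: word_perm_Cons transpose_def)
  then show ?case unfolding word_perm_append by simp
next
  case (far i j p q)
  then have "word_perm [i, j] = word_perm [j, i]"
    by (intro ext) (auto simp: word_perm_Cons transpose_def adjacent_def)
  then show ?case unfolding word_perm_append by simp
qed auto

section \<open>Inversions as a length function on permutations\<close>

definition inversions :: "nat \<Rightarrow> (nat \<Rightarrow> nat) \<Rightarrow> (nat \<times> nat) set"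
  where "inversions n p = {(a, b). 1 \<le> a \<and> a < b \<and> b \<le> n \<and> p b < p a}"

definition inv_count :: "nat \<Rightarrow> (nat \<Rightarrow> nat) \<Rightarrow> nat"
  where "inv_count n p = card (inversions n p)"

lemma finite_inversions [simp]: "finite (inversions n p)"
  by (rule finite_subset[of _ "{1..n} \<times> {1..n}"]) (auto simp: inversions_def)

lemma inv_count_id [simp]: "inv_count n id = 0"
proof -
  have "inversions n id = {}" by (auto simp: inversions_def)
  then show ?thesis by (simp add: inv_count_def)
qed

text \<open>The transposition keeps the order of every pair except \<open>(i, i + 1)\<close>, so it
  carries the old inversions injectively to new ones, and that single pair is added.\<close>

lemma inv_count_ascent:
  assumes "i \<in> {1..<n}" "p i < p (i + 1)"
  shows "inv_count n (p \<circ> transpose i (i + 1)) = inv_count n p + 1"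
proof -
  let ?t = "transpose i (i + 1)"
  have less: "?t a < ?t b" if "a < b" "(a, b) \<noteq> (i, i + 1)" for a b
    using that by (auto simp: transpose_def)
  have range: "?t a \<in> {1..n} \<longleftrightarrow> a \<in> {1..n}" for a
    using assms(1) by (auto simp: transpose_def)
  have eq: "inversions n (p \<circ> ?t) = insert (i, i + 1) (map_prod ?t ?t ` inversions n p)"
  proof (intro Set.equalityI subsetI)
    fix x assume "x \<in> inversions n (p \<circ> ?t)"
    then obtain a b where x: "x = (a, b)" "a \<in> {1..n}" "b \<in> {1..n}" "a < b" "p (?t b) < p (?t a)"
      by (auto simp: inversions_def)
    have r: "?t a \<in> {1..n}" "?t b \<in> {1..n}" by (simp_all only: range x)
    show "x \<in> insert (i, i + 1) (map_prod ?t ?t ` inversions n p)"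
    proof (cases "(a, b) = (i, i + 1)")
      case False
      have "(?t a, ?t b) \<in> inversions n p"
        using less[OF x(4) False] x r by (simp only: inversions_def atLeastAtMost_iff mem_Collect_eq prod.case)
      then have "map_prod ?t ?t (?t a, ?t b) \<in> map_prod ?t ?t ` inversions n p" by (rule imageI)
      then show ?thesis using x by simp
    qed (use x in simp)
  next
    fix x assume x: "x \<in> insert (i, i + 1) (map_prod ?t ?t ` inversions n p)"
    show "x \<in> inversions n (p \<circ> ?t)"
    proof (cases "x = (i, i + 1)")
      case True
      then show ?thesis using assms by (simp add: inversions_def)
    next
      case False
      with x obtain a b where ab: "x = (?t a, ?t b)" "(a, b) \<in> inversions n p" by auto
      then have "(a, b) \<noteq> (i, i + 1)" "a < b" using assms(2) by (auto simp: inversions_def)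
      then have "?t a < ?t b" by (intro less)
      moreover have "?t a \<in> {1..n}" "?t b \<in> {1..n}"
        unfolding range using ab(2) by (auto simp: inversions_def)
      ultimately show ?thesis using ab by (simp add: inversions_def)
    qed
  qed
  have "(i, i + 1) \<notin> map_prod ?t ?t ` inversions n p"
  proof
    assume "(i, i + 1) \<in> map_prod ?t ?t ` inversions n p"
    then obtain x where x: "(i, i + 1) = map_prod ?t ?t x" "x \<in> inversions n p" by (rule imageE)
    obtain a b where ab: "x = (a, b)" by (rule prod.exhaust)
    with x(1) have "?t i = ?t (?t a)" "?t (i + 1) = ?t (?t b)" by simp_all
    then have "a = i + 1" "b = i" by simp_all
    then show False using x(2) ab by (simp add: inversions_def)
  qed
  moreover have "inj_on (map_prod ?t ?t) (inversions n p)"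
    by (rule inj_on_subset[OF prod.inj_map]) (auto intro: inj_transpose)
  ultimately show ?thesis unfolding inv_count_def eq by (simp add: card_image)
qed

lemma inv_count_descent:
  assumes "i \<in> {1..<n}" "p (i + 1) < p i"
  shows "inv_count n p = inv_count n (p \<circ> transpose i (i + 1)) + 1"
  using inv_count_ascent[of i n "p \<circ> transpose i (i + 1)"] assms
  by (simp add: comp_assoc)

text \<open>Sending \<open>(a, b)\<close> to \<open>(p b, p a)\<close> embeds the inversions of
  \<open>p\<close> into those of the inverse; the same embedding for the inverse gives the other
  inequality.\<close>

lemma inv_count_inv:
  assumes "p permutes {1..n}"
  shows "inv_count n (inv' p) = inv_count n p"
proof -
  have le: "inv_count n p \<le> inv_count n (inv' p)" if p: "p permutes {1..n}" for p
  proof -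
    have "(\<lambda>(a, b). (p b, p a)) ` inversions n p \<subseteq> inversions n (inv' p)"
    proof clarify
      fix a b assume ab: "(a, b) \<in> inversions n p"
      have "p a \<in> {1..n}" "p b \<in> {1..n}"
        unfolding permutes_in_image[OF p] using ab by (auto simp: inversions_def)
      then show "(p b, p a) \<in> inversions n (inv' p)"
        using ab by (simp add: inversions_def permutes_inverses[OF p])
    qed
    moreover have "inj_on (\<lambda>(a, b). (p b, p a)) (inversions n p)"
      by (rule inj_onI) (auto dest: injD[OF permutes_inj[OF p]])
    ultimately show ?thesis unfolding inv_count_def by (metis card_inj_on_le finite_inversions)
  qed
  have "inv' (inv' p) = p" using permutes_inv_inv[OF assms] .
  then show ?thesis using le[OF assms] le[OF permutes_inv[OF assms]] by simp
qed

lemma inv_count_transpose_le: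
  assumes "p permutes {1..n}" "i \<in> {1..<n}"
  shows "inv_count n (p \<circ> transpose i (i + 1)) \<le> inv_count n p + 1"
proof -
  have "p i \<noteq> p (i + 1)" by (simp add: inj_eq[OF permutes_inj[OF assms(1)]])
  then consider "p i < p (i + 1)" | "p (i + 1) < p i" by linarith
  then show ?thesis
  proof cases
    case 1
    then show ?thesis using inv_count_ascent[OF assms(2), of p] by linarith
  next
    case 2
    then show ?thesis using inv_count_descent[OF assms(2), of p] by linarith
  qed
qed

lemma inv_count_comp_word_perm_le:
  assumes "w \<in> braid_words n" "p permutes {1..n}"
  shows "inv_count n (p \<circ> word_perm w) \<le> inv_count n p + length w"
  using assms(1)
proof (induction w)
  case (Cons i w)
  then have w: "w \<in> braid_words n" and i: "i \<in> {1..<n}" by auto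
  have "p \<circ> word_perm w permutes {1..n}"
    using word_perm_permutes[OF w] assms(2) by (rule permutes_compose)
  from inv_count_transpose_le[OF this i] Cons.IH show ?case
    by (simp add: word_perm_Cons comp_assoc del: comp_apply)
qed simp

lemma inv_count_word_perm_comp_le:
  assumes "w \<in> braid_words n" "p permutes {1..n}"
  shows "inv_count n (word_perm w \<circ> p) \<le> inv_count n p + length w"
proof -
  have w: "rev w \<in> braid_words n" using assms(1) by auto
  have "inv' (word_perm w \<circ> p) = inv' p \<circ> word_perm (rev w)"
    using permutes_bij[OF assms(2)] permutes_bij[OF word_perm_permutes[OF assms(1)]]
    by (simp add: word_perm_rev o_inv_distrib)
  moreover have "word_perm w \<circ> p permutes {1..n}"
    using assms word_perm_permutes permutes_compose by blast
  ultimately show ?thesis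
    using inv_count_comp_word_perm_le[OF w permutes_inv[OF assms(2)]]
      inv_count_inv[OF assms(2)] inv_count_inv[of "word_perm w \<circ> p" n] by simp
qed

section \<open>Reduced words, descents and Matsumoto's theorem\<close>

definition reduced :: "nat \<Rightarrow> nat list \<Rightarrow> bool"
  where "reduced n w \<longleftrightarrow> w \<in> braid_words n \<and> inv_count n (word_perm w) = length w"

lemma reduced_words: "reduced n w \<Longrightarrow> w \<in> braid_words n"
  by (simp add: reduced_def)

lemma reduced_Nil [simp]: "reduced n []"
  by (simp add: reduced_def)

text \<open>Equality in this bound is what \<open>reduced\<close> demands, so reduced words are the
  shortest words of their permutations.\<close>

lemma inv_count_word_perm_le: "w \<in> braid_words n \<Longrightarrow> inv_count n (word_perm w) \<le> length w"
  using inv_count_comp_word_perm_le[of w n id] by (simp add: permutes_id)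

text \<open>The inversions of the whole are at most those of one factor plus the length of the
  other. A deficit in either factor would therefore be a deficit of the whole word.\<close>

lemma reduced_appendD:
  assumes "reduced n (u @ v)"
  shows "reduced n u" and "reduced n v"
proof -
  have w: "u \<in> braid_words n" "v \<in> braid_words n" using assms by (auto simp: reduced_def)
  note le = inv_count_word_perm_le[OF w(1)] inv_count_word_perm_le[OF w(2)]
    inv_count_comp_word_perm_le[OF w(1) word_perm_permutes[OF w(2)]]
    inv_count_word_perm_comp_le[OF w(2) word_perm_permutes[OF w(1)]]
  from le assms w show "reduced n u" by (simp add: reduced_def word_perm_append)
  from le assms w show "reduced n v" by (simp add: reduced_def word_perm_append)
qed

lemma reduced_rev: "reduced n (rev w) \<longleftrightarrow> reduced n w"
proof -
  have "reduced n (rev w)" if "reduced n w" for w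
    using that inv_count_inv[OF word_perm_permutes[of w n]]
    by (auto simp: reduced_def word_perm_rev)
  from this[of w] this[of "rev w"] show ?thesis by auto
qed

lemma reduced_Cons:
  assumes "i \<in> {1..<n}"
  shows "reduced n (i # w) \<longleftrightarrow> reduced n w \<and> word_perm w i < word_perm w (i + 1)"
proof
  assume r: "reduced n (i # w)"
  then have w: "reduced n w" using reduced_appendD(2)[of n "[i]" w] by simp
  have "word_perm w i \<noteq> word_perm w (i + 1)"
    by (simp add: inj_eq[OF permutes_inj[OF word_perm_permutes[OF reduced_words[OF w]]]])
  moreover have "\<not> word_perm w (i + 1) < word_perm w i"
    using inv_count_descent[OF assms, of "word_perm w"] r w
    by (auto simp: reduced_def word_perm_Cons)
  ultimately show "reduced n w \<and> word_perm w i < word_perm w (i + 1)" using w by simp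
next
  assume "reduced n w \<and> word_perm w i < word_perm w (i + 1)"
  then show "reduced n (i # w)"
    using inv_count_ascent[OF assms, of "word_perm w"] assms
    by (auto simp: reduced_def word_perm_Cons)
qed

lemma permutes_no_descent:
  fixes p :: "nat \<Rightarrow> nat"
  assumes "p permutes {1..n}" "\<And>i. i \<in> {1..<n} \<Longrightarrow> p i < p (i + 1)"
  shows "p = id"
proof (rule permutes_natset_ge[OF assms(1)])
  have "k \<le> p k" if "1 \<le> k" "k \<le> n" for k
    using that
  proof (induction k rule: dec_induct)
    case base
    then show ?case using permutes_in_image[OF assms(1), of 1] by simp
  next
    case (step k)
    then show ?case using assms(2)[of k] by simp
  qed
  then show "\<forall>i\<in>{1..n}. p i \<ge> i" by simp
qed

text \<open>Bubble sort: undoing a descent removes exactly one inversion, and a permutation without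
  descents is the identity.\<close>

lemma reduced_exists:
  assumes "p permutes {1..n}"
  shows "\<exists>w. reduced n w \<and> word_perm w = p"
  using assms
proof (induction "inv_count n p" arbitrary: p rule: less_induct)
  case less
  show ?case
  proof (cases "\<forall>i\<in>{1..<n}. p i < p (i + 1)")
    case True
    then have "p = id" using permutes_no_descent[OF less.prems] by blast
    then show ?thesis by (intro exI[of _ "[]"]) simp
  next
    case False
    then obtain i where i: "i \<in> {1..<n}" "\<not> p i < p (i + 1)" by blast
    moreover have "p i \<noteq> p (i + 1)" by (simp add: inj_eq[OF permutes_inj[OF less.prems]])
    ultimately have d: "p (i + 1) < p i" by simp
    let ?q = "p \<circ> transpose i (i + 1)"
    have "inv_count n ?q < inv_count n p"
      using inv_count_descent[of i n p, OF i(1) d] by linarith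
    moreover have "?q permutes {1..n}"
      using transpose_Suc_permutes[OF i(1)] less.prems by (rule permutes_compose)
    ultimately obtain w where w: "reduced n w" "word_perm w = ?q"
      using less.hyps by blast
    have "reduced n (i # w)" using w d i by (subst reduced_Cons) simp_all
    moreover have "word_perm (i # w) = p" using w by (simp add: word_perm_Cons comp_assoc)
    ultimately show ?thesis by blast
  qed
qed

lemma reduced_start_descent:
  assumes "p permutes {1..n}" "i \<in> {1..<n}" "p (i + 1) < p i"
  obtains w where "reduced n (i # w)" "word_perm (i # w) = p"
proof -
  have "p \<circ> transpose i (i + 1) permutes {1..n}"
    using transpose_Suc_permutes[OF assms(2)] assms(1) by (rule permutes_compose)
  from reduced_exists[OF this] obtain w
    where w: "reduced n w" "word_perm w = p \<circ> transpose i (i + 1)" by blast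
  have "reduced n (i # w)" using w assms by (subst reduced_Cons) simp_all
  moreover have "word_perm (i # w) = p" using w by (simp add: word_perm_Cons comp_assoc)
  ultimately show thesis by (rule that)
qed

lemma permutes_comp_transpose_Suc:
  fixes i n :: nat
  shows "p permutes {1..n} \<Longrightarrow> i \<in> {1..<n} \<Longrightarrow> p \<circ> transpose i (i + 1) permutes {1..n}"
  by (rule permutes_compose[OF transpose_Suc_permutes])

text \<open>The counterpart of Garside's key lemma for permutations: with descents at
  \<open>i\<close> and \<open>j\<close>, the least common multiple of both generators can be split
  off from the front of a reduced word.\<close>

lemma reduced_start_two_descents:
  assumes p: "p permutes {1..n}" and ij: "i \<in> {1..<n}" "j \<in> {1..<n}" "i \<noteq> j"
    and d: "p (i + 1) < p i" "p (j + 1) < p j"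
  obtains z where "adjacent i j" "reduced n (i # j # i # z)" "word_perm (i # j # i # z) = p"
  | z where "\<not> adjacent i j" "reduced n (i # j # z)" "word_perm (i # j # z) = p"
proof -
  let ?q = "p \<circ> transpose i (i + 1)"
  have q: "?q permutes {1..n}" using permutes_comp_transpose_Suc p ij by blast
  have qj: "?q (j + 1) < ?q j"
    using d ij by (auto simp: transpose_def)
  have qi: "?q i < ?q (i + 1)" using d by simp
  show thesis
  proof (cases "adjacent i j")
    case True
    let ?r = "?q \<circ> transpose j (j + 1)"
    have r: "?r permutes {1..n}" using permutes_comp_transpose_Suc q ij by blast
    \<comment> \<open>The two transpositions carry the positions \<open>i\<close>,
      \<open>i + 1\<close> to \<open>j\<close>, \<open>j + 1\<close>, so this is the descent of
      \<open>p\<close> at \<open>j\<close>.\<close>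
    have "?r (i + 1) < ?r i"
      using d True by (auto simp: transpose_def adjacent_def)
    from reduced_start_descent[OF r ij(1) this] obtain z
      where z: "reduced n (i # z)" "word_perm (i # z) = ?r" .
    have jz: "word_perm (j # i # z) = ?q" using z(2)
      by (simp add: word_perm_Cons[of j] comp_assoc)
    have "reduced n (j # i # z)" using z(1) qj
      by (subst reduced_Cons[OF ij(2)]) (simp add: z(2))
    then have "reduced n (i # j # i # z)" using qi
      by (subst reduced_Cons[OF ij(1)]) (simp add: jz)
    moreover have "word_perm (i # j # i # z) = p"
      using jz by (simp add: word_perm_Cons[of i] comp_assoc)
    ultimately show thesis using True that(1) by blast
  next
    case False
    from reduced_start_descent[OF q ij(2) qj] obtain z
      where z: "reduced n (j # z)" "word_perm (j # z) = ?q" .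
    have "reduced n (i # j # z)" using qi z
      by (subst reduced_Cons[OF ij(1)]) simp
    moreover have "word_perm (i # j # z) = p"
      using z(2) by (simp add: word_perm_Cons[of i] comp_assoc)
    ultimately show thesis using False that(2) by blast
  qed
qed

lemma reduced_cong: "u \<simeq>\<^bsub>n\<^esub> v \<Longrightarrow> reduced n u \<longleftrightarrow> reduced n v"
  using word_cong_in_lists[of u v] braid_eq_length[of u v n] braid_eq_word_perm[of u v n]
  by (auto simp: reduced_def)

text \<open>The common permutation has descents at both first letters, so it also has reduced words
  \<open>i # x\<close> and \<open>j # y\<close> that are related by a single defining relation. The
  induction hypothesis compares the tail of \<open>u\<close> with \<open>x\<close> and the tail of
  \<open>v\<close> with \<open>y\<close>.\<close>

lemma matsumoto:
  assumes "reduced n u" "reduced n v" "word_perm u = word_perm v"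
  shows "u \<simeq>\<^bsub>n\<^esub> v"
  using assms
proof (induction "length u" arbitrary: u v rule: less_induct)
  case less
  have len: "length u = length v" using less.prems by (simp add: reduced_def)
  show ?case
  proof (cases u)
    case Nil
    then show ?thesis using len by (auto intro: word_cong.refl)
  next
    case (Cons i u')
    with len obtain j v' where v: "v = j # v'" by (cases v) auto
    let ?p = "word_perm u"
    have p: "?p permutes {1..n}" by (rule word_perm_permutes[OF reduced_words[OF less.prems(1)]])
    have ij: "i \<in> {1..<n}" "j \<in> {1..<n}" using less.prems Cons v by (auto simp: reduced_def)
    have red: "reduced n u'" "reduced n v'"
      using less.prems Cons v ij by (simp_all add: reduced_Cons)
    have "?p (i + 1) < ?p i"
      using less.prems(1) Cons ij by (simp add: reduced_Cons word_perm_Cons)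
    moreover have "word_perm v (j + 1) < word_perm v j"
      using less.prems(2) v ij by (simp add: reduced_Cons word_perm_Cons)
    ultimately have d: "?p (i + 1) < ?p i" "?p (j + 1) < ?p j"
      using less.prems(3) by simp_all
    have IH: "i # u' \<simeq>\<^bsub>n\<^esub> i # x" "j # v' \<simeq>\<^bsub>n\<^esub> j # y"
      if "reduced n (i # x)" "word_perm (i # x) = ?p" "reduced n (j # y)" "word_perm (j # y) = ?p" for x y
    proof -
      have "word_perm (i # u') \<circ> transpose i (i + 1) = word_perm (i # x) \<circ> transpose i (i + 1)"
        "word_perm (j # v') \<circ> transpose j (j + 1) = word_perm (j # y) \<circ> transpose j (j + 1)"
        using that Cons v less.prems by simp_all
      then have eq: "word_perm u' = word_perm x" "word_perm v' = word_perm y"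
        by (simp_all add: word_perm_Cons comp_assoc)
      have "u' \<simeq>\<^bsub>n\<^esub> x" "v' \<simeq>\<^bsub>n\<^esub> y"
        using less.hyps[of u' x] less.hyps[of v' y] red that eq ij len Cons v
        by (simp_all add: reduced_Cons)
      then show "i # u' \<simeq>\<^bsub>n\<^esub> i # x" "j # v' \<simeq>\<^bsub>n\<^esub> j # y"
        using ij by (auto intro: word_cong_Cons)
    qed
    show ?thesis
    proof (cases "i = j")
      case True
      then show ?thesis using IH(1)[of v' v'] less.prems Cons v by simp
    next
      case False
      have ex: "\<exists>x y. reduced n (i # x) \<and> word_perm (i # x) = ?p \<and> i # x \<simeq>\<^bsub>n\<^esub> j # y"
        using p ij False d
      proof (cases rule: reduced_start_two_descents)
        case (1 z)
        then have "z \<in> braid_words n" by (auto simp: reduced_def)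
        then show ?thesis using braid_eq_adj[OF 1(1) ij] 1(2,3) by blast
      next
        case (2 z)
        then have "z \<in> braid_words n" by (auto simp: reduced_def)
        then show ?thesis using braid_eq_far[OF False 2(1) ij] 2(2,3) by blast
      qed
      then obtain x y where xy: "reduced n (i # x)" "word_perm (i # x) = ?p" "i # x \<simeq>\<^bsub>n\<^esub> j # y"
        by blast
      then have "reduced n (j # y)" "word_perm (j # y) = ?p"
        using reduced_cong[OF xy(3)] braid_eq_word_perm[OF xy(3)] by simp_all
      from IH[OF xy(1,2) this] xy(3) show ?thesis unfolding Cons v
        by (blast intro: word_cong.trans word_cong.sym)
    qed
  qed
qed

lemma reduced_starts_iff:
  assumes "reduced n w" "i \<in> {1..<n}"
  shows "(\<exists>c. [i] @ c \<simeq>\<^bsub>n\<^esub> w) \<longleftrightarrow> word_perm w (i + 1) < word_perm w i"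
proof
  assume "\<exists>c. [i] @ c \<simeq>\<^bsub>n\<^esub> w"
  then obtain c where c: "i # c \<simeq>\<^bsub>n\<^esub> w" by auto
  then have "reduced n (i # c)" using assms reduced_cong by blast
  then show "word_perm w (i + 1) < word_perm w i"
    using assms(2) braid_eq_word_perm[OF c, symmetric] by (simp add: reduced_Cons word_perm_Cons)
next
  assume "word_perm w (i + 1) < word_perm w i"
  with assms obtain c where "reduced n (i # c)" "word_perm (i # c) = word_perm w"
    using reduced_start_descent[OF word_perm_permutes[OF reduced_words]] by blast
  then have "i # c \<simeq>\<^bsub>n\<^esub> w" using assms by (intro matsumoto) simp_all
  then show "\<exists>c. [i] @ c \<simeq>\<^bsub>n\<^esub> w" by auto
qed

lemma reduced_ends_iff:
  assumes "reduced n w" "i \<in> {1..<n}"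
  shows "(\<exists>c. c @ [i] \<simeq>\<^bsub>n\<^esub> w) \<longleftrightarrow> inv' (word_perm w) (i + 1) < inv' (word_perm w) i"
proof -
  have "(\<exists>c. c @ [i] \<simeq>\<^bsub>n\<^esub> w) \<longleftrightarrow> (\<exists>c. [i] @ c \<simeq>\<^bsub>n\<^esub> rev w)"
    using braid_eq_rev[of _ w n] braid_eq_rev[of _ "rev w" n]
    by (metis append_Cons append_Nil rev.simps rev_rev_ident rev_append)
  then show ?thesis
    using reduced_starts_iff[of n "rev w" i] assms by (simp only: reduced_rev word_perm_rev)
qed

section \<open>The half twist\<close>

definition half_twist :: "nat \<Rightarrow> nat \<Rightarrow> nat"
  where "half_twist n x = (if x \<in> {1..n} then n + 1 - x else x)"

lemma half_twist_involutory: "half_twist n (half_twist n x) = x"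
  by (auto simp: half_twist_def)

lemma half_twist_permutes: "half_twist n permutes {1..n}"
proof (rule bij_imp_permutes)
  show "bij_betw (half_twist n) {1..n} {1..n}"
    by (rule bij_betw_byWitness[where f' = "half_twist n"]) (auto simp: half_twist_def)
qed (auto simp: half_twist_def)

lemma half_twist_less:
  "a \<in> {1..n} \<Longrightarrow> b \<in> {1..n} \<Longrightarrow> half_twist n a < half_twist n b \<longleftrightarrow> b < a"
  by (auto simp: half_twist_def)

lemma permutes_all_descents:
  assumes p: "p permutes {1..n}" and d: "\<And>i. i \<in> {1..<n} \<Longrightarrow> p (i + 1) < p i"
  shows "p = half_twist n"
proof -
  have "half_twist n \<circ> p = id"
  proof (rule permutes_no_descent)
    show "half_twist n \<circ> p permutes {1..n}"
      using p half_twist_permutes by (rule permutes_compose)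
    fix i assume i: "i \<in> {1..<n}"
    then have "p i \<in> {1..n}" "p (i + 1) \<in> {1..n}"
      unfolding permutes_in_image[OF p] by auto
    then show "(half_twist n \<circ> p) i < (half_twist n \<circ> p) (i + 1)"
      using d[OF i] half_twist_less by simp
  qed
  show ?thesis
  proof
    fix x
    have "half_twist n (half_twist n (p x)) = half_twist n x"
      using fun_cong[OF \<open>half_twist n \<circ> p = id\<close>, of x] by simp
    then show "p x = half_twist n x" by (simp only: half_twist_involutory)
  qed
qed

text \<open>Every pair of positions is inverted by exactly one of \<open>q\<close> and its composite
  with the half twist.\<close>

lemma inv_count_half_twist_comp:
  assumes q: "q permutes {1..n}"
  shows "inv_count n (half_twist n \<circ> q) + inv_count n q = inv_count n (half_twist n)"
proof -
  have in_range: "q a \<in> {1..n}" if "a \<in> {1..n}" for a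
    using that unfolding permutes_in_image[OF q] .
  have "inversions n (half_twist n \<circ> q) \<union> inversions n q = inversions n (half_twist n)"
  proof (rule Set.set_eqI)
    fix x :: "nat \<times> nat"
    obtain a b where x: "x = (a, b)" by (rule prod.exhaust)
    show "x \<in> inversions n (half_twist n \<circ> q) \<union> inversions n q \<longleftrightarrow>
      x \<in> inversions n (half_twist n)"
    proof (cases "1 \<le> a \<and> a < b \<and> b \<le> n")
      case True
      then have "q a \<noteq> q b" by (simp add: inj_eq[OF permutes_inj[OF q]])
      moreover have "half_twist n (q b) < half_twist n (q a) \<longleftrightarrow> q a < q b"
        "half_twist n b < half_twist n a \<longleftrightarrow> a < b"
        using half_twist_less[OF in_range in_range, of b a] half_twist_less[of b n a] True
        by simp_all
      ultimately show ?thesis unfolding x using True by (auto simp: inversions_def)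
    qed (auto simp: inversions_def x)
  qed
  moreover have "inversions n (half_twist n \<circ> q) \<inter> inversions n q = {}"
  proof (rule ccontr)
    assume "inversions n (half_twist n \<circ> q) \<inter> inversions n q \<noteq> {}"
    then obtain a b where ab: "(a, b) \<in> inversions n (half_twist n \<circ> q)" "(a, b) \<in> inversions n q"
      by auto
    then have "half_twist n (q b) < half_twist n (q a) \<longleftrightarrow> q a < q b"
      by (intro half_twist_less in_range) (auto simp: inversions_def)
    with ab show False by (auto simp: inversions_def)
  qed
  ultimately show ?thesis
    unfolding inv_count_def by (metis card_Un_disjoint finite_inversions)
qed

text \<open>By Matsumoto's theorem all reduced words of the half twist are congruent, so the choice
  does not affect the braid.\<close>

definition garside_word :: "nat \<Rightarrow> nat list"
  where "garside_word n = (SOME w. reduced n w \<and> word_perm w = half_twist n)"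

lemma garside_word: "reduced n (garside_word n)" "word_perm (garside_word n) = half_twist n"
  using someI_ex[OF reduced_exists[OF half_twist_permutes]] by (simp_all add: garside_word_def)

section \<open>Left divisibility of words and the Garside element\<close>

definition braid_prefix :: "nat \<Rightarrow> nat list \<Rightarrow> nat list \<Rightarrow> bool"
  where "braid_prefix n u v \<longleftrightarrow> (\<exists>c. u @ c \<simeq>\<^bsub>n\<^esub> v)"

lemma braid_prefix_appendD: "braid_prefix n (u @ v) w \<Longrightarrow> braid_prefix n u w"
  by (auto simp: braid_prefix_def)

lemma braid_prefix_Nil: "w \<in> braid_words n \<Longrightarrow> braid_prefix n [] w"
  unfolding braid_prefix_def append_Nil by (rule exI) (rule word_cong.refl)

lemma braid_prefix_cong: "u \<simeq>\<^bsub>n\<^esub> v \<Longrightarrow> braid_prefix n u w \<Longrightarrow> braid_prefix n v w"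
proof -
  assume uv: "u \<simeq>\<^bsub>n\<^esub> v" and "braid_prefix n u w"
  then obtain c where c: "u @ c \<simeq>\<^bsub>n\<^esub> w" by (auto simp: braid_prefix_def)
  then have "u @ c \<in> braid_words n" by (rule word_cong_in_lists)
  then have "c \<in> braid_words n" by auto
  then have "u @ c \<simeq>\<^bsub>n\<^esub> v @ c" using uv by (intro word_cong_append word_cong.refl)
  from word_cong.trans[OF word_cong.sym[OF this] c] show ?thesis by (auto simp: braid_prefix_def)
qed

lemma braid_prefix_trans:
  assumes "braid_prefix n u v" "braid_prefix n v w"
  shows "braid_prefix n u w"
proof -
  from assms(1) obtain c where "u @ c \<simeq>\<^bsub>n\<^esub> v" by (auto simp: braid_prefix_def)
  then have "v \<simeq>\<^bsub>n\<^esub> u @ c" by (rule word_cong.sym)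
  from braid_prefix_cong[OF this assms(2)] show ?thesis by (rule braid_prefix_appendD)
qed

lemma braid_prefix_length: "braid_prefix n u v \<Longrightarrow> length u \<le> length v"
  unfolding braid_prefix_def using braid_eq_length by fastforce

lemma reduced_braid_prefix: "braid_prefix n u v \<Longrightarrow> reduced n v \<Longrightarrow> reduced n u"
  unfolding braid_prefix_def using reduced_cong reduced_appendD(1) by blast

text \<open>A reduced \<open>u\<close> is completed by a reduced word \<open>c\<close> of the
  permutation that remains up to the half twist. By \<open>inv_count_half_twist_comp\<close> the
  lengths add up, so \<open>u @ c\<close> is again reduced and Matsumoto's theorem applies.\<close>

lemma braid_prefix_garside_word_iff:
  "braid_prefix n u (garside_word n) \<longleftrightarrow> reduced n u"
proof
  assume u: "reduced n u"
  let ?p = "word_perm u"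
  have p: "?p permutes {1..n}" by (rule word_perm_permutes[OF reduced_words[OF u]])
  have q: "half_twist n \<circ> inv' ?p permutes {1..n}"
    using permutes_inv[OF p] half_twist_permutes by (rule permutes_compose)
  obtain c where c: "reduced n c" "word_perm c = half_twist n \<circ> inv' ?p"
    using reduced_exists[OF q] by blast
  have perm: "word_perm (u @ c) = half_twist n"
    by (simp only: word_perm_append c comp_assoc permutes_inv_o[OF p] comp_id)
  have "length c + length u = inv_count n (half_twist n)"
    using inv_count_half_twist_comp[OF permutes_inv[OF p]] c u inv_count_inv[OF p]
    by (simp add: reduced_def)
  then have "reduced n (u @ c)"
    using u c(1) perm by (auto simp: reduced_def)
  from matsumoto[OF this garside_word(1)] perm garside_word(2)
  show "braid_prefix n u (garside_word n)" by (auto simp: braid_prefix_def)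
qed (rule reduced_braid_prefix[OF _ garside_word(1)])

text \<open>After cancelling \<open>v\<close>, the key lemma applies to the two remaining
  factorisations of \<open>m\<close>.\<close>

lemma braid_prefix_two:
  assumes "braid_prefix n (v @ [s]) m" "braid_prefix n (v @ [t]) m" "s \<noteq> t"
  shows "braid_prefix n (v @ (if adjacent s t then [s, t, s] else [s, t])) m"
proof -
  from assms obtain a b where a: "v @ s # a \<simeq>\<^bsub>n\<^esub> m" and b: "v @ t # b \<simeq>\<^bsub>n\<^esub> m"
    by (auto simp: braid_prefix_def)
  have va: "v \<in> braid_words n" "s \<in> {1..<n}"
    using word_cong_in_lists(1)[OF a] by auto
  from braid_eq_append_cancel[OF word_cong.trans[OF a word_cong.sym[OF b]]]
  have "split_heads n s a t b" by (rule braid_eq_split_heads)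
  then obtain z where z: "a \<simeq>\<^bsub>n\<^esub> (if adjacent s t then [t, s] else [t]) @ z"
    using assms(3) by (auto simp: split_heads_def split: if_splits)
  then have "s # a \<simeq>\<^bsub>n\<^esub> s # (if adjacent s t then [t, s] else [t]) @ z"
    using va(2) by (rule word_cong_Cons)
  then have "v @ s # a \<simeq>\<^bsub>n\<^esub> v @ s # (if adjacent s t then [t, s] else [t]) @ z"
    using va(1) by (intro word_cong_append word_cong.refl)
  from word_cong.trans[OF word_cong.sym[OF this] a] show ?thesis
    unfolding braid_prefix_def by (intro exI[of _ z]) (auto split: if_splits)
qed

text \<open>The Garside element is the least common multiple of the generators. Given a common
  multiple \<open>m\<close>, let \<open>g\<close> be a common prefix of \<open>m\<close> and of the Garside word of maximal length. If
  some generator were not a prefix of \<open>g\<close>, there would be a longest prefix \<open>v\<close> of \<open>g\<close> having a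
  one-letter extension \<open>v @ [s]\<close> that is a common prefix but not a prefix of \<open>g\<close>; comparing it
  with the next letter \<open>t\<close> of \<open>g\<close> after \<open>v\<close>, the least common multiple of \<open>s\<close> and \<open>t\<close>
  yields a longer such \<open>v\<close>.\<close>

lemma garside_word_least:
  assumes "m \<in> braid_words n" and m: "\<And>i. i \<in> {1..<n} \<Longrightarrow> braid_prefix n [i] m"
  shows "braid_prefix n (garside_word n) m"
proof -
  let ?\<Delta> = "garside_word n"
  define common where "common x \<longleftrightarrow> braid_prefix n x m \<and> braid_prefix n x ?\<Delta>" for x
  have "common []"
    unfolding common_def using assms(1) reduced_words[OF garside_word(1)]
    by (blast intro: braid_prefix_Nil)
  moreover have "\<forall>x. common x \<longrightarrow> length x < Suc (length m)"
    unfolding common_def less_Suc_eq_le using braid_prefix_length by blast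
  ultimately obtain g where g: "common g" and gmax: "\<And>x. common x \<Longrightarrow> length x \<le> length g"
    using ex_has_greatest_nat[of common "[]" length "Suc (length m)"] by blast
  have two: "common (v @ (if adjacent s t then [s, t, s] else [s, t]))"
    if "common (v @ [s])" "common (v @ [t])" "s \<noteq> t" for v s t
    using that braid_prefix_two unfolding common_def by blast
  have commonD: "common u" if "common (u @ v)" for u v
    using that braid_prefix_appendD unfolding common_def by blast
  have "reduced n g" using g by (simp add: common_def braid_prefix_garside_word_iff)
  note g_words = reduced_words[OF this]
  have "braid_prefix n [i] g" if i: "i \<in> {1..<n}" for i
  proof (rule ccontr)
    assume not: "\<not> braid_prefix n [i] g"
    define bad where "bad v \<longleftrightarrow>
      braid_prefix n v g \<and> (\<exists>s. common (v @ [s]) \<and> \<not> braid_prefix n (v @ [s]) g)" for v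
    have "reduced n [i]" using i by (simp add: reduced_Cons)
    then have "common [i]" using m[OF i] by (simp add: common_def braid_prefix_garside_word_iff)
    then have "bad []"
      using not braid_prefix_Nil[OF g_words] unfolding bad_def append_Nil by blast
    moreover have "\<forall>v. bad v \<longrightarrow> length v < Suc (length g)"
      unfolding bad_def less_Suc_eq_le using braid_prefix_length by blast
    ultimately obtain v where v: "bad v" and vmax: "\<And>x. bad x \<Longrightarrow> length x \<le> length v"
      using ex_has_greatest_nat[of bad "[]" length "Suc (length g)"] by blast
    from v obtain s c where s: "common (v @ [s])" "\<not> braid_prefix n (v @ [s]) g"
      and c: "v @ c \<simeq>\<^bsub>n\<^esub> g" by (auto simp: bad_def braid_prefix_def)
    have "c \<noteq> []"
      using gmax[OF s(1)] braid_eq_length[OF c] by auto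
    then obtain t r where "c = t # r" by (cases c) auto
    then have vt: "braid_prefix n (v @ [t]) g" using c by (auto simp: braid_prefix_def)
    then have ct: "common (v @ [t])" using g braid_prefix_trans unfolding common_def by blast
    have st: "s \<noteq> t" using s vt by auto
    \<comment> \<open>Maximality of \<open>v\<close>: a prefix of \<open>g\<close> longer than
      \<open>v\<close> is not \<open>bad\<close>, so each of its common one-letter extensions still
      divides \<open>g\<close>.\<close>
    have step: "braid_prefix n (w @ [x]) g"
      if "braid_prefix n w g" "common (w @ [x])" "length w > length v" for w x
      using vmax[of w] that unfolding bad_def by (meson not_le)
    have "v \<in> braid_words n" "s \<in> {1..<n}" "t \<in> {1..<n}"
      using s(1) ct
      by (auto simp: common_def braid_prefix_garside_word_iff dest!: reduced_words)
    note gens = this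
    have "braid_prefix n (v @ [s]) g"
    proof (cases "adjacent s t")
      case True
      have tst: "common (v @ [t, s, t])"
        using two[OF ct s(1)] True st by (simp add: adjacent_sym)
      then have ts: "common (v @ [t, s])" using commonD[of "v @ [t, s]" "[t]"] by simp
      have "braid_prefix n (v @ [t, s]) g" using step[OF vt] ts by simp
      then have "braid_prefix n (v @ [t, s, t]) g" using step[of "v @ [t, s]" t] tst by simp
      moreover have "v @ [t, s, t] \<simeq>\<^bsub>n\<^esub> v @ [s, t, s]"
        using braid_eq_adj[of t s n "[]"] True gens
        by (intro word_cong_append word_cong.refl) (simp_all add: adjacent_sym)
      ultimately have "braid_prefix n (v @ [s, t, s]) g" by (rule braid_prefix_cong[rotated])
      then show ?thesis using braid_prefix_appendD[of n "v @ [s]" "[t, s]"] by simp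
    next
      case False
      then have "common (v @ [t, s])"
        using two[OF ct s(1)] st by (simp add: adjacent_sym)
      then have "braid_prefix n (v @ [t, s]) g" using step[OF vt] by simp
      moreover have "v @ [t, s] \<simeq>\<^bsub>n\<^esub> v @ [s, t]"
        using braid_eq_far[of t s n "[]"] False gens st
        by (intro word_cong_append word_cong.refl) (simp_all add: adjacent_sym)
      ultimately have "braid_prefix n (v @ [s, t]) g" by (rule braid_prefix_cong[rotated])
      then show ?thesis using braid_prefix_appendD[of n "v @ [s]" "[t]"] by simp
    qed
    with s(2) show False by simp
  qed
  note all = this
  \<comment> \<open>Divisibility by every generator means a descent everywhere. Hence
    \<open>g\<close> represents the Garside element itself, and \<open>g\<close> divides
    \<open>m\<close> by its choice.\<close>
  have "word_perm g = half_twist n"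
    using all[unfolded braid_prefix_def] reduced_starts_iff[OF \<open>reduced n g\<close>]
    by (intro permutes_all_descents word_perm_permutes g_words) blast
  then have "g \<simeq>\<^bsub>n\<^esub> ?\<Delta>"
    using matsumoto[OF \<open>reduced n g\<close> garside_word(1)] garside_word(2) by simp
  moreover have "braid_prefix n g m" using g by (simp add: common_def)
  ultimately show ?thesis by (rule braid_prefix_cong)
qed

section \<open>Simple elements and permutations\<close>

abbreviation braid_class :: "nat \<Rightarrow> nat list \<Rightarrow> nat list set"
  where "braid_class n w \<equiv> word_cong {1..<n} (braid_relations n) `` {w}"

lemma braid_gen_eq: "braid_gen n i = braid_class n [i]"
  by (simp add: braid_gen_def)

lemma braid_class_eq_iff:
  assumes "u \<in> braid_words n" "v \<in> braid_words n"
  shows "braid_class n u = braid_class n v \<longleftrightarrow> u \<simeq>\<^bsub>n\<^esub> v"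
  by (rule eq_equiv_class_iff[OF equiv_word_cong assms])

lemma carrier_braid_monoid: "carrier (braid_monoid n) = braid_class n ` braid_words n"
  by (auto simp: braid_monoid_def presented_monoid_def quotient_def)

text \<open>The product is a union over all representatives; compatibility with concatenation
  collapses it to one class.\<close>

lemma mult_braid_class:
  assumes "u \<in> braid_words n" "v \<in> braid_words n"
  shows "braid_class n u \<otimes>\<^bsub>braid_monoid n\<^esub> braid_class n v = braid_class n (u @ v)"
proof -
  have "braid_class n (u' @ v') = braid_class n (u @ v)"
    if "u' \<in> braid_class n u" "v' \<in> braid_class n v" for u' v'
  proof -
    have "u @ v \<simeq>\<^bsub>n\<^esub> u' @ v'" using that by (auto intro: word_cong_append)
    from equiv_class_eq[OF equiv_word_cong this] show ?thesis by (rule HOL.sym)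
  qed
  moreover have "u \<in> braid_class n u" "v \<in> braid_class n v"
    using assms by (blast intro: word_cong.refl)+
  ultimately show ?thesis
    unfolding braid_monoid_def presented_monoid_def monoid.simps by blast
qed

lemma divides_braid_class_iff:
  assumes u: "u \<in> braid_words n" and v: "v \<in> braid_words n"
  shows "braid_class n u divides\<^bsub>braid_monoid n\<^esub> braid_class n v \<longleftrightarrow> braid_prefix n u v"
proof
  assume "braid_class n u divides\<^bsub>braid_monoid n\<^esub> braid_class n v"
  then obtain c where c: "c \<in> braid_words n"
    "braid_class n v = braid_class n u \<otimes>\<^bsub>braid_monoid n\<^esub> braid_class n c"
    by (auto simp: factor_def carrier_braid_monoid)
  then have "braid_class n (u @ c) = braid_class n v" using mult_braid_class[OF u c(1)] by simp
  then have "u @ c \<simeq>\<^bsub>n\<^esub> v"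
    using u v c(1) by (subst (asm) braid_class_eq_iff) auto
  then show "braid_prefix n u v" by (auto simp: braid_prefix_def)
next
  assume "braid_prefix n u v"
  then obtain c where c: "u @ c \<simeq>\<^bsub>n\<^esub> v" by (auto simp: braid_prefix_def)
  from word_cong_in_lists(1)[OF this] have w: "c \<in> braid_words n" by simp
  have "braid_class n v = braid_class n u \<otimes>\<^bsub>braid_monoid n\<^esub> braid_class n c"
    unfolding mult_braid_class[OF u w] using equiv_class_eq[OF equiv_word_cong c] by simp
  then show "braid_class n u divides\<^bsub>braid_monoid n\<^esub> braid_class n v"
    unfolding factor_def carrier_braid_monoid using w by blast
qed

lemma right_divides_braid_class_iff:
  assumes u: "u \<in> braid_words n" and v: "v \<in> braid_words n"
  shows "right_divides (braid_monoid n) (braid_class n u) (braid_class n v) \<longleftrightarrow> (\<exists>c. c @ u \<simeq>\<^bsub>n\<^esub> v)"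
proof
  assume "right_divides (braid_monoid n) (braid_class n u) (braid_class n v)"
  then obtain c where c: "c \<in> braid_words n"
    "braid_class n v = braid_class n c \<otimes>\<^bsub>braid_monoid n\<^esub> braid_class n u"
    by (auto simp: right_divides_def carrier_braid_monoid)
  then have "braid_class n (c @ u) = braid_class n v" using mult_braid_class[OF c(1) u] by simp
  then have "c @ u \<simeq>\<^bsub>n\<^esub> v"
    using u v c(1) by (subst (asm) braid_class_eq_iff) auto
  then show "\<exists>c. c @ u \<simeq>\<^bsub>n\<^esub> v" ..
next
  assume "\<exists>c. c @ u \<simeq>\<^bsub>n\<^esub> v"
  then obtain c where c: "c @ u \<simeq>\<^bsub>n\<^esub> v" ..
  from word_cong_in_lists(1)[OF this] have w: "c \<in> braid_words n" by simp
  have "braid_class n v = braid_class n c \<otimes>\<^bsub>braid_monoid n\<^esub> braid_class n u"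
    unfolding mult_braid_class[OF w u] using equiv_class_eq[OF equiv_word_cong c] by simp
  then show "right_divides (braid_monoid n) (braid_class n u) (braid_class n v)"
    unfolding right_divides_def carrier_braid_monoid using w by blast
qed

text \<open>Congruent words have equal length, so mutual division forces an empty cofactor. This
  gives the uniqueness behind the definite description in \<open>garside\<close>.\<close>

lemma divides_braid_monoid_antisym:
  assumes "x \<in> carrier (braid_monoid n)" "y \<in> carrier (braid_monoid n)"
    and "x divides\<^bsub>braid_monoid n\<^esub> y" "y divides\<^bsub>braid_monoid n\<^esub> x"
  shows "x = y"
proof -
  obtain u v where x: "x = braid_class n u" "u \<in> braid_words n"
    and y: "y = braid_class n v" "v \<in> braid_words n"
    using assms(1,2) unfolding carrier_braid_monoid by blast
  have uv: "braid_prefix n u v" "braid_prefix n v u"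
    using assms(3,4) unfolding x(1) y(1) divides_braid_class_iff[OF x(2) y(2)]
      divides_braid_class_iff[OF y(2) x(2)] .
  then obtain c where c: "u @ c \<simeq>\<^bsub>n\<^esub> v" by (auto simp: braid_prefix_def)
  from braid_eq_length[OF c] braid_prefix_length[OF uv(2)] have "length c = 0"
    unfolding length_append by linarith
  then show ?thesis using c equiv_class_eq[OF equiv_word_cong] x y by simp
qed

lemma braid_gen_words: "i \<in> {1..<n} \<Longrightarrow> [i] \<in> braid_words n"
  by simp

lemma garside_eq: "garside n = braid_class n (garside_word n)"
  unfolding garside_def
proof (rule the_equality)
  note gw = reduced_words[OF garside_word(1), of n]
  show lcm: "is_left_lcm (braid_monoid n) (atoms n) (braid_class n (garside_word n))"
    unfolding is_left_lcm_def
  proof (intro conjI ballI impI)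
    show "braid_class n (garside_word n) \<in> carrier (braid_monoid n)"
      using gw unfolding carrier_braid_monoid by blast
    fix a assume "a \<in> atoms n"
    then obtain i where i: "i \<in> {1..<n}" "a = braid_class n [i]"
      by (auto simp: atoms_def braid_gen_eq)
    have "reduced n [i]" using i by (simp add: reduced_Cons)
    then show "a divides\<^bsub>braid_monoid n\<^esub> braid_class n (garside_word n)"
      unfolding i(2) divides_braid_class_iff[OF braid_gen_words[OF i(1)] gw]
        braid_prefix_garside_word_iff .
  next
    fix m assume "m \<in> carrier (braid_monoid n)"
      and div: "\<forall>a\<in>atoms n. a divides\<^bsub>braid_monoid n\<^esub> m"
    then obtain w where w: "w \<in> braid_words n" "m = braid_class n w"
      by (auto simp: carrier_braid_monoid)
    have "braid_prefix n (garside_word n) w"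
    proof (rule garside_word_least[OF w(1)])
      fix i assume i: "i \<in> {1..<n}"
      then have "braid_class n [i] divides\<^bsub>braid_monoid n\<^esub> m"
        using div by (auto simp: atoms_def braid_gen_eq)
      then show "braid_prefix n [i] w"
        unfolding w(2) divides_braid_class_iff[OF braid_gen_words[OF i] w(1)] .
    qed
    then show "braid_class n (garside_word n) divides\<^bsub>braid_monoid n\<^esub> m"
      unfolding w(2) divides_braid_class_iff[OF gw w(1)] .
  qed
  fix d assume "is_left_lcm (braid_monoid n) (atoms n) d"
  with lcm show "d = braid_class n (garside_word n)"
    by (intro divides_braid_monoid_antisym) (auto simp: is_left_lcm_def)
qed

lemma simples_eq: "simples n = braid_class n ` {w. reduced n w}"
proof -
  note gw = reduced_words[OF garside_word(1), of n]
  have "simples n = {x \<in> braid_class n ` braid_words n.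
      x divides\<^bsub>braid_monoid n\<^esub> braid_class n (garside_word n)}"
    unfolding simples_def garside_eq carrier_braid_monoid ..
  also have "\<dots> = braid_class n ` {w \<in> braid_words n. reduced n w}"
    using divides_braid_class_iff[OF _ gw] braid_prefix_garside_word_iff by blast
  also have "{w \<in> braid_words n. reduced n w} = {w. reduced n w}"
    using reduced_words by blast
  finally show ?thesis .
qed

section \<open>Simple elements as permutations\<close>

lemma braid_perm_class:
  assumes "w \<in> braid_words n"
  shows "braid_perm (braid_class n w) = word_perm w"
proof -
  have "word_perm ` braid_class n w = {word_perm w}"
    using braid_eq_word_perm word_cong.refl[OF assms] by fastforce
  then show ?thesis by (simp add: braid_perm_def)
qed

lemma braid_perm_gen: "i \<in> {1..<n} \<Longrightarrow> braid_perm (braid_gen n i) = transpose i (i + 1)"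
  unfolding braid_gen_eq by (subst braid_perm_class) simp_all

text \<open>Distinct indices induce distinct transpositions. Sets of atoms can therefore be replaced
  by sets of indices.\<close>

lemma inj_on_braid_gen: "inj_on (braid_gen n) {1..<n}"
proof (rule inj_onI)
  fix i j assume ij: "i \<in> {1..<n}" "j \<in> {1..<n}" "braid_gen n i = braid_gen n j"
  then have "transpose i (i + 1) = transpose j (j + 1)" using braid_perm_gen by metis
  from fun_cong[OF this, of i] fun_cong[OF this, of j] show "i = j"
    by (auto simp: transpose_def split: if_splits)
qed

lemma bij_betw_braid_perm: "bij_betw braid_perm (simples n) {p. p permutes {1..n}}"
  unfolding bij_betw_def
proof
  show "inj_on braid_perm (simples n)"
  proof (rule inj_onI)
    fix x y assume "x \<in> simples n" "y \<in> simples n" and eq: "braid_perm x = braid_perm y"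
    then obtain u v where "reduced n u" "x = braid_class n u" "reduced n v" "y = braid_class n v"
      unfolding simples_eq by blast
    moreover from this eq have "u \<simeq>\<^bsub>n\<^esub> v"
      by (intro matsumoto) (simp_all only: braid_perm_class[OF reduced_words])
    ultimately show "x = y" using equiv_class_eq[OF equiv_word_cong] by simp
  qed
  show "braid_perm ` simples n = {p. p permutes {1..n}}"
  proof -
    have "braid_perm ` simples n = word_perm ` {w. reduced n w}"
      unfolding simples_eq image_image using braid_perm_class[OF reduced_words]
      by (intro image_cong) simp_all
    also have "\<dots> = {p. p permutes {1..n}}"
      using word_perm_permutes[OF reduced_words] reduced_exists by blast
    finally show ?thesis .
  qed
qed

lemma starting_set_simple:
  assumes "s \<in> simples n"
  shows "starting_set n s =
    braid_gen n ` {i \<in> {1..<n}. braid_perm s (i + 1) < braid_perm s i}"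
proof -
  from assms obtain w where w: "reduced n w" "s = braid_class n w" unfolding simples_eq by blast
  have "starting_set n s = braid_gen n ` {i \<in> {1..<n}. braid_gen n i divides\<^bsub>braid_monoid n\<^esub> s}"
    by (auto simp: starting_set_def atoms_def)
  also have "{i \<in> {1..<n}. braid_gen n i divides\<^bsub>braid_monoid n\<^esub> s} =
      {i \<in> {1..<n}. braid_perm s (i + 1) < braid_perm s i}"
    unfolding w(2) braid_gen_eq braid_perm_class[OF reduced_words[OF w(1)]]
    using divides_braid_class_iff[OF braid_gen_words reduced_words[OF w(1)]]
      reduced_starts_iff[OF w(1)]
    unfolding braid_prefix_def by blast
  finally show ?thesis .
qed

lemma finishing_set_simple:
  assumes "s \<in> simples n"
  shows "finishing_set n s =
    braid_gen n ` {i \<in> {1..<n}. inv' (braid_perm s) (i + 1) < inv' (braid_perm s) i}"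
proof -
  from assms obtain w where w: "reduced n w" "s = braid_class n w" unfolding simples_eq by blast
  have "finishing_set n s = braid_gen n ` {i \<in> {1..<n}. right_divides (braid_monoid n) (braid_gen n i) s}"
    by (auto simp: finishing_set_def atoms_def)
  also have "{i \<in> {1..<n}. right_divides (braid_monoid n) (braid_gen n i) s} =
      {i \<in> {1..<n}. inv' (braid_perm s) (i + 1) < inv' (braid_perm s) i}"
    unfolding w(2) braid_gen_eq braid_perm_class[OF reduced_words[OF w(1)]]
    using right_divides_braid_class_iff[OF braid_gen_words reduced_words[OF w(1)]]
      reduced_ends_iff[OF w(1)]
    by blast
  finally show ?thesis .
qed

lemma card_transitions:
  assumes I: "I \<subseteq> {1..<n}" and J: "J \<subseteq> {1..<n}" "J \<noteq> {}"
  shows "card {(p, s, q) \<in> transitions (normal_form_automaton n).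
      p = braid_gen n ` I \<and> q \<in> accepting (normal_form_automaton n) \<and> braid_gen n ` J \<subseteq> q} =
    card {p. p permutes {1..n} \<and> (\<forall>i\<in>{1..<n} - I. p i < p (i + 1)) \<and>
      (\<forall>i\<in>J. inv' p (i + 1) < inv' p i)}"
    (is "card ?T = card ?P")
proof -
  let ?X = "braid_gen n ` I" and ?Y = "braid_gen n ` J"
  let ?S = "{s \<in> simples n. starting_set n s \<subseteq> ?X \<and> ?Y \<subseteq> finishing_set n s}"
  have X: "?X \<subseteq> atoms n" using I by (auto simp: atoms_def)
  have F: "finishing_set n s \<subseteq> atoms n" for s by (auto simp: finishing_set_def)
  \<comment> \<open>A transition is determined by its source and letter. Nonemptiness of
    \<open>J\<close> excludes the failure state and makes the target accepting.\<close>
  have mem: "(p, s, q) \<in> ?T \<longleftrightarrow> p = ?X \<and> q = finishing_set n s \<and> s \<in> ?S" for p s q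
    using X F[of s] J(2) unfolding transitions_def normal_form_automaton_def by auto
  have "?T = (\<lambda>s. (?X, s, finishing_set n s)) ` ?S"
  proof (rule Set.set_eqI)
    fix x
    show "x \<in> ?T \<longleftrightarrow> x \<in> (\<lambda>s. (?X, s, finishing_set n s)) ` ?S"
      by (cases x rule: prod_cases3) (simp only: mem, blast)
  qed
  then have "card ?T = card ?S" by (simp add: card_image inj_on_def)
  also have "card ?S = card ?P"
  proof (rule bij_betw_same_card)
    have perm: "braid_perm s \<in> ?P \<longleftrightarrow> s \<in> ?S" if s: "s \<in> simples n" for s
    proof -
      let ?p = "braid_perm s"
      have p: "?p permutes {1..n}" using bij_betw_apply[OF bij_betw_braid_perm s] by simp
      have sub: "braid_gen n ` A \<subseteq> braid_gen n ` B \<longleftrightarrow> A \<subseteq> B"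
        if "A \<subseteq> {1..<n}" "B \<subseteq> {1..<n}" for A B
      proof (intro iffI subsetI)
        fix x assume "braid_gen n ` A \<subseteq> braid_gen n ` B" and x: "x \<in> A"
        then have "braid_gen n x \<in> braid_gen n ` B" by blast
        moreover have "x \<in> {1..<n}" using x that(1) by blast
        ultimately show "x \<in> B" using inj_on_image_mem_iff[OF inj_on_braid_gen _ that(2)] by blast
      qed blast
      have total: "?p i < ?p (i + 1) \<longleftrightarrow> \<not> ?p (i + 1) < ?p i" for i
      proof -
        have "?p i \<noteq> ?p (i + 1)" by (simp add: inj_eq[OF permutes_inj[OF p]])
        then show ?thesis by linarith
      qed
      \<comment> \<open>The complement of \<open>X\<close> arises here: descents outside
        \<open>I\<close> are forbidden, and a permutation without a descent at \<open>i\<close>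
        strictly ascends there.\<close>
      have "{i \<in> {1..<n}. ?p (i + 1) < ?p i} \<subseteq> I \<longleftrightarrow> (\<forall>i\<in>{1..<n} - I. ?p i < ?p (i + 1))"
        unfolding total by blast
      then have 1: "starting_set n s \<subseteq> ?X \<longleftrightarrow> (\<forall>i\<in>{1..<n} - I. ?p i < ?p (i + 1))"
        unfolding starting_set_simple[OF s] by (subst sub[OF _ I]) blast+
      have "J \<subseteq> {i \<in> {1..<n}. inv' ?p (i + 1) < inv' ?p i} \<longleftrightarrow> (\<forall>i\<in>J. inv' ?p (i + 1) < inv' ?p i)"
        using J(1) by blast
      then have 2: "?Y \<subseteq> finishing_set n s \<longleftrightarrow> (\<forall>i\<in>J. inv' ?p (i + 1) < inv' ?p i)"
        unfolding finishing_set_simple[OF s] by (subst sub[OF J(1)]) blast+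
      show ?thesis unfolding mem_Collect_eq 1 2 using s p by blast
    qed
    have "braid_perm ` ?S = ?P"
    proof (intro Set.equalityI subsetI)
      fix p assume "p \<in> braid_perm ` ?S"
      then obtain s where s: "p = braid_perm s" "s \<in> ?S" by (rule imageE)
      from CollectD[OF s(2)] have "s \<in> simples n" by (rule conjunct1)
      from perm[OF this] s(2) show "p \<in> ?P" unfolding s(1) by (rule iffD2)
    next
      fix p assume p: "p \<in> ?P"
      then have "p \<in> braid_perm ` simples n"
        unfolding bij_betw_imp_surj_on[OF bij_betw_braid_perm] by blast
      then obtain s where s: "p = braid_perm s" "s \<in> simples n" by (rule imageE)
      have "s \<in> ?S" using perm[OF s(2)] p unfolding s(1) by (rule iffD1)
      with s(1) show "p \<in> braid_perm ` ?S" by (rule image_eqI)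
    qed
    then show "bij_betw braid_perm ?S ?P"
      using bij_betw_subset[OF bij_betw_braid_perm, of ?S] by blast
  qed
  finally show ?thesis .
qed

section \<open>Counting permutations by bipartite graphs\<close>

lemma strict_mono_on_unique:
  fixes h k :: "'a :: wellorder \<Rightarrow> 'b :: linorder"
  assumes h: "strict_mono_on A h" and k: "strict_mono_on A k" and im: "h ` A = k ` A" and x: "x \<in> A"
  shows "h x = k x"
  using x
proof (induction x rule: less_induct)
  case (less x)
  \<comment> \<open>At a first disagreement the smaller value \<open>h x\<close> must be taken by
    \<open>k\<close> at an earlier point, where both functions agree; then \<open>h\<close> takes it
    twice.\<close>
  have no: "\<not> h x < k x"
    if h: "strict_mono_on A h" and k: "strict_mono_on A k" and im: "h ` A = k ` A"
      and eq: "\<And>y. y \<in> A \<Longrightarrow> y < x \<Longrightarrow> h y = k y" for h k :: "'a \<Rightarrow> 'b"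
  proof
    assume lt: "h x < k x"
    from im less.prems obtain z where z: "z \<in> A" "h x = k z" by blast
    then have "z < x"
      using lt strict_mono_onD[OF k less.prems z(1)] by (metis not_less_iff_gr_or_eq)
    then have "h z = h x" using eq z by metis
    with strict_mono_onD[OF h z(1) less.prems \<open>z < x\<close>] show False by simp
  qed
  from no[OF h k im] no[OF k h im[symmetric]] less.IH show ?case
    by (metis linorder_neqE)
qed

lemma ex_strict_mono_on_bij_betw:
  fixes A :: "'a :: linorder set" and B :: "'b :: linorder set"
  assumes "finite A" "finite B" "card A = card B"
  shows "\<exists>h. bij_betw h A B \<and> strict_mono_on A h"
  using assms
proof (induction A arbitrary: B rule: finite_linorder_max_induct)
  case empty
  then show ?case by (simp add: bij_betw_def)
next
  case (insert b A)
  have "b \<notin> A" using insert.hyps by auto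
  then have card: "card B = Suc (card A)" using insert by simp
  then have "B \<noteq> {}" by auto
  let ?m = "Max B"
  have m: "?m \<in> B" using insert.prems(1) \<open>B \<noteq> {}\<close> by simp
  have "card A = card (B - {?m})" using card m by simp
  then obtain h where h: "bij_betw h A (B - {?m})" "strict_mono_on A h"
    using insert.IH[of "B - {?m}"] insert.prems(1) by auto
  let ?h = "h(b := ?m)"
  have less: "h x < ?m" if "x \<in> A" for x
  proof -
    have "h x \<in> B - {?m}" using h(1) that by (rule bij_betw_apply)
    then show ?thesis using Max_ge[OF insert.prems(1), of "h x"] by (simp add: less_le)
  qed
  have "bij_betw ?h A (B - {?m})"
    using h(1) \<open>b \<notin> A\<close> by (subst bij_betw_cong[of A ?h h]) auto
  then have "bij_betw ?h (insert b A) (insert ?m (B - {?m}))"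
    using \<open>b \<notin> A\<close> notIn_Un_bij_betw[of b A ?h "B - {?m}"] by simp
  moreover have "insert ?m (B - {?m}) = B" using m by blast
  moreover have "strict_mono_on (insert b A) ?h"
  proof (rule strict_mono_onI)
    fix x y assume xy: "x \<in> insert b A" "y \<in> insert b A" "x < y"
    then have "x \<in> A" "x \<noteq> b" using insert.hyps by auto
    then show "?h x < ?h y" using xy less h(2) by (auto dest: strict_mono_onD)
  qed
  ultimately show ?case by metis
qed

text \<open>Negation reverses the order of the target. It is carried out in the integers, and
  \<open>nat\<close> leads back afterwards.\<close>

lemma ex_strict_antimono_on_bij_betw:
  fixes A :: "'a :: linorder set" and B :: "nat set"
  assumes "finite A" "finite B" "card A = card B"
  shows "\<exists>h. bij_betw h A B \<and> (\<forall>x\<in>A. \<forall>y\<in>A. x < y \<longrightarrow> h y < h x)"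
proof -
  let ?neg = "\<lambda>b :: nat. - int b"
  have inj: "inj_on ?neg B" by (simp add: inj_on_def)
  then have "card A = card (?neg ` B)" using assms by (simp add: card_image)
  then obtain h where h: "bij_betw h A (?neg ` B)" "strict_mono_on A h"
    using ex_strict_mono_on_bij_betw[of A "?neg ` B"] assms by auto
  have "bij_betw (\<lambda>c. nat (- c)) (?neg ` B) B"
    by (rule bij_betw_byWitness[where f' = ?neg]) auto
  from bij_betw_trans[OF h(1) this] have bij: "bij_betw (\<lambda>x. nat (- h x)) A B"
    by (simp add: comp_def)
  moreover have "nat (- h y) < nat (- h x)" if "x \<in> A" "y \<in> A" "x < y" for x y
  proof -
    have "h x \<in> ?neg ` B" "h y \<in> ?neg ` B" using bij_betw_apply[OF h(1)] that by blast+
    then show ?thesis using strict_mono_onD[OF h(2) that] by auto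
  qed
  ultimately show ?thesis by (intro exI[of _ "\<lambda>x. nat (- h x)"]) blast
qed

text \<open>A permutation that increases on the fibres of \<open>g\<close> and whose inverse decreases on the fibres of
  \<open>f\<close> maps at most one point of each fibre of \<open>g\<close> into each fibre of \<open>f\<close>, so it is encoded
  by a simple graph on the two sets of fibres.\<close>

definition monotone_perms :: "nat set \<Rightarrow> (nat \<Rightarrow> nat) \<Rightarrow> (nat \<Rightarrow> nat) \<Rightarrow> (nat \<Rightarrow> nat) set"
  where "monotone_perms S f g = {p. p permutes S \<and>
    (\<forall>x\<in>S. \<forall>y\<in>S. x < y \<longrightarrow> g x = g y \<longrightarrow> p x < p y) \<and>
    (\<forall>x\<in>S. \<forall>y\<in>S. x < y \<longrightarrow> f x = f y \<longrightarrow> inv' p y < inv' p x)}"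

text \<open>Rows stand for fibres of \<open>f\<close>, which collect values of \<open>p\<close>, and
  columns for fibres of \<open>g\<close>, which collect arguments. With \<open>f\<close> numbering
  the orbits of Y, rows become the left vertices of the graph.\<close>

definition fibre_graph :: "nat set \<Rightarrow> (nat \<Rightarrow> nat) \<Rightarrow> (nat \<Rightarrow> nat) \<Rightarrow> (nat \<Rightarrow> nat) \<Rightarrow> (nat \<times> nat) set"
  where "fibre_graph S f g p = (\<lambda>x. (f (p x), g x)) ` S"

context
  fixes S :: "nat set" and f g :: "nat \<Rightarrow> nat" and p :: "nat \<Rightarrow> nat"
  assumes f: "mono_on S f" and g: "mono_on S g" and p: "p \<in> monotone_perms S f g"
begin

lemma monotone_perms_permutes: "p permutes S"
  using p by (simp add: monotone_perms_def)

lemma fibre_graph_inv: "fibre_graph S f g p = (\<lambda>y. (f y, g (inv' p y))) ` S"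
proof -
  have "fibre_graph S f g p = (\<lambda>x. (f (p x), g (inv' p (p x)))) ` S"
    using permutes_inverses(2)[OF monotone_perms_permutes] by (simp add: fibre_graph_def)
  also have "\<dots> = (\<lambda>y. (f y, g (inv' p y))) ` p ` S"
    by (simp only: image_image)
  finally show ?thesis unfolding permutes_image[OF monotone_perms_permutes] .
qed

text \<open>Strictness expresses simplicity of the graph: if two points of a \<open>g\<close>-fibre
  had values in one \<open>f\<close>-fibre, \<open>p\<close> would preserve their order while its
  inverse reversed it.\<close>

lemma fibre_graph_column:
  "strict_mono_on {x \<in> S. g x = j} (\<lambda>x. f (p x))"
  "(\<lambda>x. f (p x)) ` {x \<in> S. g x = j} = {i. (i, j) \<in> fibre_graph S f g p}"
proof -
  note P = monotone_perms_permutes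
  show "strict_mono_on {x \<in> S. g x = j} (\<lambda>x. f (p x))"
  proof (rule strict_mono_onI)
    fix x y assume xy: "x \<in> {x \<in> S. g x = j}" "y \<in> {x \<in> S. g x = j}" "x < y"
    then have S: "x \<in> S" "y \<in> S" "p x \<in> S" "p y \<in> S"
      by (auto simp: permutes_in_image[OF P])
    have lt: "p x < p y" using p xy by (auto simp: monotone_perms_def)
    then have "f (p x) \<le> f (p y)" using mono_onD[OF f S(3,4)] by simp
    moreover have "f (p x) \<noteq> f (p y)"
    proof
      assume "f (p x) = f (p y)"
      with p lt S have "inv' p (p y) < inv' p (p x)"
        by (auto simp: monotone_perms_def)
      then show False using xy by (simp add: permutes_inverses[OF P])
    qed
    ultimately show "f (p x) < f (p y)" by simp
  qed
  show "(\<lambda>x. f (p x)) ` {x \<in> S. g x = j} = {i. (i, j) \<in> fibre_graph S f g p}"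
    by (auto simp: fibre_graph_def)
qed

text \<open>The dual of \<open>fibre_graph_column\<close>. Rows are traversed downwards, and
  negation brings this into the increasing form required by
  \<open>strict_mono_on_unique\<close>.\<close>

lemma fibre_graph_row:
  "strict_mono_on {y \<in> S. f y = i} (\<lambda>y. - int (g (inv' p y)))"
  "(\<lambda>y. g (inv' p y)) ` {y \<in> S. f y = i} = {j. (i, j) \<in> fibre_graph S f g p}"
proof -
  note P = monotone_perms_permutes
  show "strict_mono_on {y \<in> S. f y = i} (\<lambda>y. - int (g (inv' p y)))"
  proof (rule strict_mono_onI)
    fix x y assume xy: "x \<in> {x \<in> S. f x = i}" "y \<in> {x \<in> S. f x = i}" "x < y"
    then have S: "x \<in> S" "y \<in> S" "inv' p x \<in> S" "inv' p y \<in> S"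
      by (auto simp: permutes_in_image[OF permutes_inv[OF P]])
    have lt: "inv' p y < inv' p x" using p xy by (auto simp: monotone_perms_def)
    then have "g (inv' p y) \<le> g (inv' p x)" using mono_onD[OF g S(4,3)] by simp
    moreover have "g (inv' p y) \<noteq> g (inv' p x)"
    proof
      assume "g (inv' p y) = g (inv' p x)"
      with p lt S have "p (inv' p y) < p (inv' p x)"
        by (auto simp: monotone_perms_def)
      then show False using xy by (simp add: permutes_inverses[OF P])
    qed
    ultimately show "- int (g (inv' p x)) < - int (g (inv' p y))" by simp
  qed
  show "(\<lambda>y. g (inv' p y)) ` {y \<in> S. f y = i} = {j. (i, j) \<in> fibre_graph S f g p}"
    unfolding fibre_graph_inv by auto
qed

lemma card_fibre_graph:
  "card {i. (i, j) \<in> fibre_graph S f g p} = card {x \<in> S. g x = j}"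
  "card {j. (i, j) \<in> fibre_graph S f g p} = card {y \<in> S. f y = i}"
proof -
  show "card {i. (i, j) \<in> fibre_graph S f g p} = card {x \<in> S. g x = j}"
    unfolding fibre_graph_column(2)[symmetric]
    by (rule card_image) (rule strict_mono_on_imp_inj_on[OF fibre_graph_column(1)])
  have "inj_on (\<lambda>y. g (inv' p y)) {y \<in> S. f y = i}"
    using strict_mono_on_imp_inj_on[OF fibre_graph_row(1)] by (auto simp: inj_on_def)
  then show "card {j. (i, j) \<in> fibre_graph S f g p} = card {y \<in> S. f y = i}"
    unfolding fibre_graph_row(2)[symmetric] by (rule card_image)
qed

end

text \<open>Columns of the graph determine \<open>f (p x)\<close>, rows determine
  \<open>g (inv' p y)\<close>. Thus \<open>p x\<close> and \<open>q x\<close> lie in one fibre of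
  \<open>f\<close> and have preimages under \<open>p\<close> in one fibre of \<open>g\<close>, and a
  row meets such a pair of fibres only once.\<close>

lemma inj_on_fibre_graph:
  assumes f: "mono_on S f" and g: "mono_on S g"
  shows "inj_on (fibre_graph S f g) (monotone_perms S f g)"
proof (rule inj_onI)
  fix p q assume p: "p \<in> monotone_perms S f g" and q: "q \<in> monotone_perms S f g"
    and eq: "fibre_graph S f g p = fibre_graph S f g q"
  note P = monotone_perms_permutes[OF f g p] and Q = monotone_perms_permutes[OF f g q]
  note col = fibre_graph_column[OF f g] and row = fibre_graph_row[OF f g]
  have fpq: "f (p x) = f (q x)" if "x \<in> S" for x
    using strict_mono_on_unique[OF col(1)[OF p, of "g x"] col(1)[OF q, of "g x"]] that
    by (simp add: col(2)[OF p] col(2)[OF q] eq)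
  have gpq: "g (inv' p y) = g (inv' q y)" if "y \<in> S" for y
  proof -
    have "(\<lambda>j. - int j) ` (\<lambda>y. g (inv' p y)) ` {y' \<in> S. f y' = f y} =
        (\<lambda>j. - int j) ` (\<lambda>y. g (inv' q y)) ` {y' \<in> S. f y' = f y}"
      unfolding row(2)[OF p] row(2)[OF q] eq ..
    then have "- int (g (inv' p y)) = - int (g (inv' q y))"
      unfolding image_image
      by (rule strict_mono_on_unique[OF row(1)[OF p] row(1)[OF q]]) (use that in simp)
    then show ?thesis by simp
  qed
  show "p = q"
  proof
    fix x
    show "p x = q x"
    proof (cases "x \<in> S")
      case True
      then have S: "p x \<in> S" "q x \<in> S"
        using permutes_in_image[OF P] permutes_in_image[OF Q] by simp_all
      have "- int (g (inv' p (p x))) = - int (g (inv' p (q x)))"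
        using gpq[OF S(2)] by (simp add: permutes_inverses[OF P] permutes_inverses[OF Q])
      moreover have "p x \<in> {y \<in> S. f y = f (p x)}" "q x \<in> {y \<in> S. f y = f (p x)}"
        using S fpq[OF True] by simp_all
      ultimately show ?thesis
        by (rule inj_onD[OF strict_mono_on_imp_inj_on[OF row(1)[OF p]]])
    next
      case False
      then show ?thesis using P Q by (simp add: permutes_not_in)
    qed
  qed
qed

text \<open>The degree conditions allow column \<open>j\<close> of \<open>E\<close> to be matched
  increasingly with fibre \<open>j\<close> of \<open>g\<close> (the maps \<open>a\<close>), and row
  \<open>i\<close> decreasingly with fibre \<open>i\<close> of \<open>f\<close> (the maps
  \<open>b\<close>). Glued together these give bijections from \<open>E\<close> onto
  \<open>S\<close>, one for arguments and one for values, and \<open>p\<close> sends the argument of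
  each edge to its value.\<close>

lemma fibre_graph_surj:
  assumes f: "mono_on S f" and g: "mono_on S g" and fin: "finite S"
    and ranges: "f ` S = {..<r}" "g ` S = {..<s}"
    and E: "E \<subseteq> {..<r} \<times> {..<s}"
    and row: "\<And>i. i < r \<Longrightarrow> card {j. (i, j) \<in> E} = card {y \<in> S. f y = i}"
    and col: "\<And>j. j < s \<Longrightarrow> card {i. (i, j) \<in> E} = card {x \<in> S. g x = j}"
  shows "\<exists>p \<in> monotone_perms S f g. fibre_graph S f g p = E"
proof -
  have finite_fibre: "finite {x \<in> S. P x}" for P using fin by simp
  have finE: "finite E" using E by (rule finite_subset) simp
  have fin_row: "finite {j. (i, j) \<in> E}" for i
    by (rule finite_subset[of _ "snd ` E"]) (use finE in \<open>force+\<close>)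
  have fin_col: "finite {i. (i, j) \<in> E}" for j
    by (rule finite_subset[of _ "fst ` E"]) (use finE in \<open>force+\<close>)
  have "\<forall>j\<in>{..<s}. \<exists>h. bij_betw h {i. (i, j) \<in> E} {x \<in> S. g x = j} \<and> strict_mono_on {i. (i, j) \<in> E} h"
    using ex_strict_mono_on_bij_betw[OF fin_col finite_fibre col] by blast
  from bchoice[OF this] obtain a where "\<forall>j\<in>{..<s}.
      bij_betw (a j) {i. (i, j) \<in> E} {x \<in> S. g x = j} \<and> strict_mono_on {i. (i, j) \<in> E} (a j)" ..
  then have a: "\<And>j. j < s \<Longrightarrow> bij_betw (a j) {i. (i, j) \<in> E} {x \<in> S. g x = j}"
    "\<And>j. j < s \<Longrightarrow> strict_mono_on {i. (i, j) \<in> E} (a j)" by blast+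
  have "\<forall>i\<in>{..<r}. \<exists>h. bij_betw h {j. (i, j) \<in> E} {y \<in> S. f y = i} \<and>
      (\<forall>x\<in>{j. (i, j) \<in> E}. \<forall>y\<in>{j. (i, j) \<in> E}. x < y \<longrightarrow> h y < h x)"
    using ex_strict_antimono_on_bij_betw[OF fin_row finite_fibre row] by blast
  from bchoice[OF this] obtain b where "\<forall>i\<in>{..<r}.
      bij_betw (b i) {j. (i, j) \<in> E} {y \<in> S. f y = i} \<and>
      (\<forall>x\<in>{j. (i, j) \<in> E}. \<forall>y\<in>{j. (i, j) \<in> E}. x < y \<longrightarrow> b i y < b i x)" ..
  then have b: "\<And>i. i < r \<Longrightarrow> bij_betw (b i) {j. (i, j) \<in> E} {y \<in> S. f y = i}"
    "\<And>i x y. i < r \<Longrightarrow> (i, x) \<in> E \<Longrightarrow> (i, y) \<in> E \<Longrightarrow> x < y \<Longrightarrow> b i y < b i x" by blast+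
  define \<alpha> where "\<alpha> e = a (snd e) (fst e)" for e
  define \<beta> where "\<beta> e = b (fst e) (snd e)" for e
  have \<alpha>: "\<alpha> e \<in> S" "g (\<alpha> e) = snd e" and \<beta>: "\<beta> e \<in> S" "f (\<beta> e) = fst e" if "e \<in> E" for e
    using that E bij_betw_apply[OF a(1), of "snd e" "fst e"] bij_betw_apply[OF b(1), of "fst e" "snd e"]
    by (auto simp: \<alpha>_def \<beta>_def)
  have bij\<alpha>: "bij_betw \<alpha> E S"
  proof (rule bij_betw_imageI)
    show "inj_on \<alpha> E"
    proof (rule inj_onI)
      fix e e' assume e: "e \<in> E" "e' \<in> E" "\<alpha> e = \<alpha> e'"
      then have snd: "snd e = snd e'" using \<alpha>(2) by metis
      have "(fst e, snd e') \<in> E" using e(1) by (simp flip: snd)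
      note e = e this
      have "snd e < s" using e(1) E by auto
      from inj_onD[OF bij_betw_imp_inj_on[OF a(1)[OF this]], of "fst e" "fst e'"]
      have "fst e = fst e'" using e snd by (simp add: \<alpha>_def)
      with snd show "e = e'" by (rule prod_eqI[rotated])
    qed
    show "\<alpha> ` E = S"
    proof (intro Set.equalityI subsetI)
      fix x assume x: "x \<in> S"
      then have "g x < s" using ranges(2) by auto
      from bij_betw_imp_surj_on[OF a(1)[OF this]] x obtain i where "(i, g x) \<in> E" "x = a (g x) i"
        by blast
      then show "x \<in> \<alpha> ` E" by (intro image_eqI[of _ _ "(i, g x)"]) (simp_all add: \<alpha>_def)
    qed (use \<alpha>(1) in auto)
  qed
  have bij\<beta>: "bij_betw \<beta> E S"
  proof (rule bij_betw_imageI)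
    show "inj_on \<beta> E"
    proof (rule inj_onI)
      fix e e' assume e: "e \<in> E" "e' \<in> E" "\<beta> e = \<beta> e'"
      then have fst: "fst e = fst e'" using \<beta>(2) by metis
      have "(fst e', snd e) \<in> E" using e(1) by (simp flip: fst)
      note e = e this
      have "fst e < r" using e(1) E by auto
      from inj_onD[OF bij_betw_imp_inj_on[OF b(1)[OF this]], of "snd e" "snd e'"]
      have "snd e = snd e'" using e fst by (simp add: \<beta>_def)
      with fst show "e = e'" by (rule prod_eqI)
    qed
    show "\<beta> ` E = S"
    proof (intro Set.equalityI subsetI)
      fix y assume y: "y \<in> S"
      then have "f y < r" using ranges(1) by auto
      from bij_betw_imp_surj_on[OF b(1)[OF this]] y obtain j where "(f y, j) \<in> E" "y = b (f y) j"
        by blast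
      then show "y \<in> \<beta> ` E" by (intro image_eqI[of _ _ "(f y, j)"]) (simp_all add: \<beta>_def)
    qed (use \<beta>(1) in auto)
  qed
  define p where "p x = (if x \<in> S then \<beta> (inv_into E \<alpha> x) else x)" for x
  have p: "p (\<alpha> e) = \<beta> e" if "e \<in> E" for e
    using that \<alpha>(1) bij_betw_imp_inj_on[OF bij\<alpha>] by (simp add: p_def)
  have "bij_betw p S S"
    using bij_betw_trans[OF bij_betw_inv_into[OF bij\<alpha>] bij\<beta>]
    by (subst bij_betw_cong[of S p "\<beta> \<circ> inv_into E \<alpha>"]) (simp_all add: p_def)
  then have perm: "p permutes S" by (rule bij_imp_permutes) (simp add: p_def)
  have inv_p: "inv' p (\<beta> e) = \<alpha> e" if "e \<in> E" for e
    using p[OF that] permutes_inverses(2)[OF perm, of "\<alpha> e"] by simp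
  have "p \<in> monotone_perms S f g"
    unfolding monotone_perms_def mem_Collect_eq
  proof (intro conjI ballI impI)
    show "p permutes S" by (rule perm)
  next
    fix x y assume xy: "x \<in> S" "y \<in> S" "x < y" "g x = g y"
    obtain e e' where e: "e \<in> E" "x = \<alpha> e" and e': "e' \<in> E" "y = \<alpha> e'"
      using xy(1,2) bij_betw_imp_surj_on[OF bij\<alpha>] by blast
    have snd: "snd e = snd e'" using xy(4) e e' \<alpha>(2) by simp
    have mem: "(fst e, snd e') \<in> E" using e(1) by (simp flip: snd)
    have s: "snd e < s" using e(1) E by auto
    have "fst e < fst e'"
    proof (rule ccontr)
      assume "\<not> fst e < fst e'"
      then have "a (snd e) (fst e') \<le> a (snd e) (fst e)"
        using strict_mono_onD[OF a(2)[OF s], of "fst e'" "fst e"] mem e'(1) snd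
        by (cases "fst e = fst e'") (auto intro: less_imp_le)
      then show False using xy(3) e(2) e'(2) snd by (simp add: \<alpha>_def)
    qed
    \<comment> \<open>Since \<open>f\<close> is monotone, comparing fibre numbers of the values is
      enough to compare the values.\<close>
    then have "f (p x) < f (p y)" using e e' p \<beta>(2) by simp
    moreover have "p x \<in> S" "p y \<in> S" using xy by (simp_all add: permutes_in_image[OF perm])
    ultimately show "p x < p y"
      using mono_onD[OF f, of "p y" "p x"] by (meson leD not_le)
  next
    fix x y assume xy: "x \<in> S" "y \<in> S" "x < y" "f x = f y"
    obtain e e' where e: "e \<in> E" "x = \<beta> e" and e': "e' \<in> E" "y = \<beta> e'"
      using xy(1,2) bij_betw_imp_surj_on[OF bij\<beta>] by blast
    have fst: "fst e = fst e'" using xy(4) e e' \<beta>(2) by simp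
    have mem: "(fst e', snd e) \<in> E" using e(1) by (simp flip: fst)
    have r: "fst e < r" using e(1) E by auto
    have "snd e' < snd e"
    proof (rule ccontr)
      assume "\<not> snd e' < snd e"
      then have "b (fst e) (snd e') \<le> b (fst e) (snd e)"
        using b(2)[OF r, of "snd e" "snd e'"] mem e'(1) fst
        by (cases "snd e = snd e'") (auto intro: less_imp_le)
      then show False using xy(3) e(2) e'(2) fst by (simp add: \<beta>_def)
    qed
    then have "g (inv' p y) < g (inv' p x)" using e e' inv_p \<alpha>(2) by simp
    moreover have "inv' p x \<in> S" "inv' p y \<in> S"
      using xy by (simp_all add: permutes_in_image[OF permutes_inv[OF perm]])
    ultimately show "inv' p y < inv' p x"
      using mono_onD[OF g, of "inv' p x" "inv' p y"] by (meson leD not_le)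
  qed
  moreover have "fibre_graph S f g p = E"
  proof -
    have "fibre_graph S f g p = (\<lambda>x. (f (p x), g x)) ` \<alpha> ` E"
      unfolding fibre_graph_def bij_betw_imp_surj_on[OF bij\<alpha>] ..
    also have "\<dots> = (\<lambda>e. e) ` E"
      unfolding image_image by (rule image_cong) (simp_all add: p \<alpha> \<beta>)
    finally show ?thesis by simp
  qed
  ultimately show ?thesis by blast
qed

lemma card_monotone_perms:
  assumes f: "mono_on S f" and g: "mono_on S g" and fin: "finite S"
    and ranges: "f ` S = {..<r}" "g ` S = {..<s}"
  shows "card (monotone_perms S f g) =
    num_bipartite (map (\<lambda>i. card {y \<in> S. f y = i}) [0..<r]) (map (\<lambda>j. card {x \<in> S. g x = j}) [0..<s])"
proof -
  let ?B = "bipartite_graphs (map (\<lambda>i. card {y \<in> S. f y = i}) [0..<r]) (map (\<lambda>j. card {x \<in> S. g x = j}) [0..<s])"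
  have B: "?B = {E. E \<subseteq> {..<r} \<times> {..<s} \<and>
      (\<forall>i<r. card {j. (i, j) \<in> E} = card {y \<in> S. f y = i}) \<and>
      (\<forall>j<s. card {i. (i, j) \<in> E} = card {x \<in> S. g x = j})}"
    unfolding bipartite_graphs_def by (simp cong: conj_cong)
  have "fibre_graph S f g ` monotone_perms S f g = ?B"
  proof (intro Set.equalityI subsetI)
    fix E assume "E \<in> fibre_graph S f g ` monotone_perms S f g"
    then obtain p where p: "E = fibre_graph S f g p" "p \<in> monotone_perms S f g" by (rule imageE)
    have "E \<subseteq> {..<r} \<times> {..<s}"
      unfolding p(1) fibre_graph_def ranges[symmetric]
      using permutes_in_image[OF monotone_perms_permutes[OF f g p(2)]] by auto
    then show "E \<in> ?B" unfolding B mem_Collect_eq using card_fibre_graph[OF f g p(2)] unfolding p(1) by blast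
  next
    fix E assume "E \<in> ?B"
    then have "\<exists>p \<in> monotone_perms S f g. fibre_graph S f g p = E"
      unfolding B mem_Collect_eq by (intro fibre_graph_surj[OF f g fin ranges]) blast+
    then show "E \<in> fibre_graph S f g ` monotone_perms S f g" by blast
  qed
  then show ?thesis
    unfolding num_bipartite_def using card_image[OF inj_on_fibre_graph[OF f g]] by simp
qed

section \<open>Orbits of standard parabolic subgroups\<close>

text \<open>The number of the orbit of \<open>x\<close> under the transpositions \<open>(k k+1)\<close> with \<open>k \<in> Z\<close>,
  counted from the left: every \<open>k \<notin> Z\<close> separates \<open>k\<close> from \<open>k + 1\<close>.\<close>

definition block :: "nat set \<Rightarrow> nat \<Rightarrow> nat"
  where "block Z x = card ({1..<x} - Z)"

lemma block_Suc: "1 \<le> x \<Longrightarrow> block Z (Suc x) = block Z x + (if x \<in> Z then 0 else 1)"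
proof -
  assume "1 \<le> x"
  then have "{1..<Suc x} - Z = (if x \<in> Z then {1..<x} - Z else insert x ({1..<x} - Z))"
    by (auto simp: less_Suc_eq)
  then show ?thesis by (simp add: block_def)
qed

lemma mono_block: "mono (block Z)"
  unfolding block_def by (intro monoI card_mono) auto

text \<open>Block numbers start at 0 and grow by at most one per step, so none is skipped.\<close>

lemma block_range:
  assumes "1 \<le> n"
  shows "block Z ` {1..n} = {..<Suc (block Z n)}"
  using assms
proof (induction n rule: dec_induct)
  case base
  then show ?case by (auto simp: block_def)
next
  case (step n)
  have "block Z ` {1..Suc n} = insert (block Z (Suc n)) (block Z ` {1..n})"
    using step.hyps by (simp add: atLeastAtMostSuc_conv)
  then show ?case using step block_Suc[of n Z] by (auto simp: less_Suc_eq)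
qed

text \<open>Monotonicity of \<open>block\<close> keeps all points between \<open>x\<close> and
  \<open>y\<close> in the same block, so every step between them belongs to \<open>Z\<close> and the
  ascents chain together.\<close>

lemma block_ascent_iff:
  fixes h :: "nat \<Rightarrow> nat"
  assumes "Z \<subseteq> {1..<n}"
  shows "(\<forall>i\<in>Z. h i < h (i + 1)) \<longleftrightarrow>
    (\<forall>x\<in>{1..n}. \<forall>y\<in>{1..n}. x < y \<longrightarrow> block Z x = block Z y \<longrightarrow> h x < h y)"
proof
  assume h: "\<forall>i\<in>Z. h i < h (i + 1)"
  have "h x < h y" if "1 \<le> x" "Suc x \<le> y" "block Z x = block Z y" for x y
    using that(2,3)
  proof (induction y rule: dec_induct)
    case base
    then have "x \<in> Z" using block_Suc[OF that(1), of Z] by (auto split: if_splits)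
    then show ?case using h by simp
  next
    case (step y)
    have "block Z x \<le> block Z y" "block Z y \<le> block Z (Suc y)"
      using step.hyps by (auto intro!: monoD[OF mono_block])
    then have eq: "block Z x = block Z y" "block Z (Suc y) = block Z y" using step.prems by simp_all
    then have "y \<in> Z" using block_Suc[of y Z] step.hyps by (auto split: if_splits)
    then have "h y < h (Suc y)" using h by simp
    with step.IH[OF eq(1)] show ?case by (rule less_trans)
  qed
  then show "\<forall>x\<in>{1..n}. \<forall>y\<in>{1..n}. x < y \<longrightarrow> block Z x = block Z y \<longrightarrow> h x < h y"
    by simp
next
  assume h: "\<forall>x\<in>{1..n}. \<forall>y\<in>{1..n}. x < y \<longrightarrow> block Z x = block Z y \<longrightarrow> h x < h y"
  show "\<forall>i\<in>Z. h i < h (i + 1)"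
  proof
    fix i assume i: "i \<in> Z"
    then have r: "i \<in> {1..n}" "i + 1 \<in> {1..n}" "1 \<le> i" using assms by fastforce+
    then have "block Z i = block Z (i + 1)" using i block_Suc[of i Z] by simp
    with h r show "h i < h (i + 1)" by simp
  qed
qed

text \<open>Apply \<open>block_ascent_iff\<close> to \<open>n - h x\<close>; the bound keeps
  truncated subtraction order-reversing.\<close>

lemma block_descent_iff:
  fixes h :: "nat \<Rightarrow> nat"
  assumes "Z \<subseteq> {1..<n}" and bound: "\<And>x. x \<in> {1..n} \<Longrightarrow> h x \<le> n"
  shows "(\<forall>i\<in>Z. h (i + 1) < h i) \<longleftrightarrow>
    (\<forall>x\<in>{1..n}. \<forall>y\<in>{1..n}. x < y \<longrightarrow> block Z x = block Z y \<longrightarrow> h y < h x)"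
proof -
  have eq: "n - h x < n - h y \<longleftrightarrow> h y < h x" if "x \<in> {1..n}" "y \<in> {1..n}" for x y
    using bound[OF that(1)] bound[OF that(2)] by linarith
  have r: "i \<in> {1..n}" "i + 1 \<in> {1..n}" if "i \<in> Z" for i using that assms(1) by fastforce+
  have "(\<forall>i\<in>Z. h (i + 1) < h i) \<longleftrightarrow> (\<forall>i\<in>Z. n - h i < n - h (i + 1))"
    by (intro ball_cong HOL.refl eq[symmetric] r)
  also have "\<dots> \<longleftrightarrow>
      (\<forall>x\<in>{1..n}. \<forall>y\<in>{1..n}. x < y \<longrightarrow> block Z x = block Z y \<longrightarrow> n - h x < n - h y)"
    by (rule block_ascent_iff[OF assms(1)])
  also have "\<dots> \<longleftrightarrow> (\<forall>x\<in>{1..n}. \<forall>y\<in>{1..n}. x < y \<longrightarrow> block Z x = block Z y \<longrightarrow> h y < h x)"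
    by (intro ball_cong HOL.refl) (simp only: eq)
  finally show ?thesis .
qed

text \<open>Strict sortedness of the keys also makes the key function injective on the set, as
  \<open>folding_insort_key\<close> requires.\<close>

lemma (in linorder) sorted_key_list_of_set_eqI:
  assumes "sorted_wrt (<) (map f xs)"
  shows "sorted_key_list_of_set f (set xs) = xs"
proof -
  have s: "sorted (map f xs)" "distinct xs" "inj_on f (set xs)"
    using assms by (simp_all add: strict_sorted_iff distinct_map)
  interpret folding_insort_key "(\<le>)" "(<)" "set xs" f
    by unfold_locales (rule s(3))
  show ?thesis by (rule idem_if_sorted_distinct[OF subset_refl s(1,2)])
qed

section \<open>Orbits as blocks, and the degree sequence\<close>

context
  fixes n :: nat and Z :: "nat set"
  assumes Z: "Z \<subseteq> {1..<n}"
begin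

abbreviation parabolic :: "(nat \<Rightarrow> nat) set"
  where "parabolic \<equiv> generate (sym_group n) (braid_perm ` braid_gen n ` Z)"

lemma parabolic_generators: "braid_perm ` braid_gen n ` Z = (\<lambda>i. transpose i (i + 1)) ` Z"
  unfolding image_image using braid_perm_gen Z by (intro image_cong) blast+

lemma transpose_in_parabolic: "i \<in> Z \<Longrightarrow> transpose i (i + 1) \<in> parabolic"
  unfolding parabolic_generators by (intro generate.incl imageI)

lemma parabolic_block:
  assumes "h \<in> parabolic"
  shows "h permutes {1..n} \<and> (\<forall>x. block Z (h x) = block Z x)"
proof -
  \<comment> \<open>The involution clause makes each generator its own group inverse, which settles
    the case \<open>inv\<close> of \<open>generate\<close>.\<close>
  have gen: "h permutes {1..n} \<and> (\<forall>x. block Z (h x) = block Z x) \<and> h \<circ> h = id"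
    if "h \<in> (\<lambda>i. transpose i (i + 1)) ` Z" for h
  proof -
    from that obtain i where i: "i \<in> Z" "h = transpose i (i + 1)" by blast
    then have r: "i \<in> {1..<n}" using Z by blast
    then have "block Z (i + 1) = block Z i" using block_Suc[of i Z] i by simp
    then have "\<forall>x. block Z (h x) = block Z x" unfolding i(2) by (simp add: transpose_def)
    then show ?thesis using transpose_Suc_permutes[OF r] i(2) by simp
  qed
  from assms show ?thesis
    unfolding parabolic_generators
  proof induction
    case one
    then show ?case unfolding sym_group_one by (intro conjI permutes_id) simp
  next
    case (incl h)
    then show ?case using gen by blast
  next
    case (inv h)
    have h: "h permutes {1..n}" "h \<circ> h = id" using gen[OF inv] by blast+
    have "inv\<^bsub>sym_group n\<^esub> h = h"
      by (rule group.inv_equality[OF sym_group_is_group])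
        (simp_all only: sym_group_mult sym_group_one sym_group_carrier h)
    then show ?case using gen[OF inv] by simp
  next
    case (eng h k)
    then have "h \<circ> k permutes {1..n}" by (intro permutes_compose) simp_all
    moreover have "\<forall>x. block Z ((h \<circ> k) x) = block Z x" using eng.IH by simp
    ultimately show ?case unfolding sym_group_mult by (rule conjI)
  qed
qed

text \<open>One transposition is added for each step from \<open>x\<close> up to \<open>y\<close>.
  Both directions are carried along, so that closure of the subgroup under inverses need not be
  invoked.\<close>

lemma parabolic_connects:
  assumes "1 \<le> x" "x \<le> y" "block Z x = block Z y"
  shows "(\<exists>h\<in>parabolic. h x = y) \<and> (\<exists>h\<in>parabolic. h y = x)"
  using assms(2,3)
proof (induction y rule: dec_induct)
  case base
  have "id \<in> parabolic" using generate.one[of "sym_group n"] by (simp only: sym_group_one)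
  then show ?case by (metis id_apply)
next
  case (step y)
  have "block Z x \<le> block Z y" "block Z y \<le> block Z (Suc y)"
    using step.hyps by (auto intro!: monoD[OF mono_block])
  then have eq: "block Z x = block Z y" "block Z (Suc y) = block Z y" using step.prems by simp_all
  then have "y \<in> Z" using block_Suc[of y Z] step.hyps assms(1) by (auto split: if_splits)
  note t = transpose_in_parabolic[OF this]
  have comp: "h \<circ> k \<in> parabolic" if "h \<in> parabolic" "k \<in> parabolic" for h k
    using generate.eng[OF that] by (simp only: sym_group_mult)
  from step.IH[OF eq(1)] obtain h k where h: "h \<in> parabolic" "h x = y" and k: "k \<in> parabolic" "k y = x"
    by blast
  have "(transpose y (y + 1) \<circ> h) x = Suc y" "(k \<circ> transpose y (y + 1)) (Suc y) = x"
    using h k by simp_all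
  then show ?case using comp[OF t h(1)] comp[OF k(1) t] by blast
qed

lemma strand_orbits_eq:
  assumes "1 \<le> n"
  shows "strand_orbits n (braid_gen n ` Z) = (\<lambda>j. {x \<in> {1..n}. block Z x = j}) ` {..<Suc (block Z n)}"
proof -
  have "strand_orbits n (braid_gen n ` Z) = (\<lambda>x. {h x | h. h \<in> parabolic}) ` {1..n}"
    by (auto simp: strand_orbits_def orbits_def orbit_def)
  also have "\<dots> = (\<lambda>x. {y \<in> {1..n}. block Z y = block Z x}) ` {1..n}"
  proof (rule image_cong[OF HOL.refl], intro Set.equalityI subsetI)
    fix x y assume x: "x \<in> {1..n}" and "y \<in> {h x | h. h \<in> parabolic}"
    then obtain h where h: "h \<in> parabolic" "y = h x" by blast
    then show "y \<in> {y \<in> {1..n}. block Z y = block Z x}"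
      using parabolic_block[OF h(1)] x permutes_in_image[of h "{1..n}" x] by simp
  next
    fix x y assume "x \<in> {1..n}" "y \<in> {y \<in> {1..n}. block Z y = block Z x}"
    then have r: "1 \<le> x" "1 \<le> y" "block Z y = block Z x" by simp_all
    have "\<exists>h\<in>parabolic. h x = y"
    proof (cases "x \<le> y")
      case True
      then show ?thesis using parabolic_connects[of x y] r by simp
    next
      case False
      then show ?thesis using parabolic_connects[of y x] r by simp
    qed
    then show "y \<in> {h x | h. h \<in> parabolic}" by blast
  qed
  also have "\<dots> = (\<lambda>j. {x \<in> {1..n}. block Z x = j}) ` block Z ` {1..n}"
    by (simp only: image_image)
  finally show ?thesis unfolding block_range[OF assms] .
qed

text \<open>Blocks are level sets of a monotone function, so listing them by number lists them by
  minimum.\<close>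

lemma deg_seq_eq:
  assumes "1 \<le> n"
  shows "deg_seq n (braid_gen n ` Z) =
    map (\<lambda>j. card {x \<in> {1..n}. block Z x = j}) [0..<Suc (block Z n)]"
proof -
  let ?L = "\<lambda>j. {x \<in> {1..n}. block Z x = j}" and ?m = "Suc (block Z n)"
  let ?xs = "map ?L [0..<?m]"
  have Min: "Min (?L j) \<in> ?L j" if "j < ?m" for j
  proof (rule Min_in)
    have "j \<in> block Z ` {1..n}" using that unfolding block_range[OF assms] by simp
    then show "?L j \<noteq> {}" by blast
  qed simp
  have less: "Min (?L i) < Min (?L j)" if "i < j" "j < ?m" for i j
  proof (rule ccontr)
    assume "\<not> Min (?L i) < Min (?L j)"
    then have "block Z (Min (?L j)) \<le> block Z (Min (?L i))"
      by (intro monoD[OF mono_block]) simp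
    then show False using Min[of i] Min[of j] that by simp
  qed
  have sorted: "sorted_wrt (<) (map Min ?xs)"
    using less by (simp add: sorted_wrt_iff_nth_less del: upt_Suc)
  have set: "set ?xs = ?L ` {..<?m}" by (simp only: set_map set_upt atLeast0LessThan)
  have "sorted_key_list_of_set Min (?L ` {..<?m}) = ?xs"
    using sorted_key_list_of_set_eqI[OF sorted] unfolding set .
  then show ?thesis
    unfolding deg_seq_def strand_orbits_eq[OF assms] by (simp del: upt_Suc)
qed

end

theorem theorem4p3:
  fixes n :: nat and X Y :: "nat list set set"
  assumes "X \<subseteq> atoms n" and "Y \<subseteq> atoms n" and "Y \<noteq> {}"
  shows "card {(p, s, q) \<in> transitions (normal_form_automaton n).
            p = X \<and> q \<in> accepting (normal_form_automaton n) \<and> Y \<subseteq> q}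
         = num_bipartite (deg_seq n Y) (deg_seq n (atoms n - X))"
proof -
  obtain I where I: "I \<subseteq> {1..<n}" "X = braid_gen n ` I"
    using assms(1) unfolding atoms_def by (rule subset_imageE)
  obtain J where J: "J \<subseteq> {1..<n}" "Y = braid_gen n ` J"
    using assms(2) unfolding atoms_def by (rule subset_imageE)
  have "J \<noteq> {}" using assms(3) J(2) by blast
  \<comment> \<open>\<open>block_range\<close> fails for \<open>n = 0\<close>, where no point lies
    in block 0.\<close>
  then have n: "1 \<le> n" using J(1) by fastforce
  let ?K = "{1..<n} - I"
  have K: "?K \<subseteq> {1..<n}" by blast
  have compl: "atoms n - X = braid_gen n ` ?K"
    unfolding atoms_def I(2) using inj_on_image_set_diff[OF inj_on_braid_gen _ I(1)] by blast
  let ?P = "{p. p permutes {1..n} \<and> (\<forall>i\<in>?K. p i < p (i + 1)) \<and> (\<forall>i\<in>J. inv' p (i + 1) < inv' p i)}"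
  have "?P = monotone_perms {1..n} (block J) (block ?K)"
  proof -
    have "(\<forall>i\<in>J. inv' p (i + 1) < inv' p i) \<longleftrightarrow>
        (\<forall>x\<in>{1..n}. \<forall>y\<in>{1..n}. x < y \<longrightarrow> block J x = block J y \<longrightarrow> inv' p y < inv' p x)"
      if "p permutes {1..n}" for p
    proof (rule block_descent_iff[OF J(1)])
      fix x assume "x \<in> {1..n}"
      then have "inv' p x \<in> {1..n}" unfolding permutes_in_image[OF permutes_inv[OF that]] .
      then show "inv' p x \<le> n" by simp
    qed
    note descent = this
    show ?thesis
      unfolding monotone_perms_def
      by (intro Collect_cong conj_cong HOL.refl block_ascent_iff[OF K] descent)
  qed
  moreover have "mono_on {1..n} (block Z)" for Z
    by (rule mono_on_subset[OF mono_block subset_UNIV])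
  note card_monotone_perms[OF this this finite_atLeastAtMost block_range[OF n] block_range[OF n], of J ?K]
  ultimately show ?thesis
    \<comment> \<open>This rewriting comes first because \<open>compl\<close> mentions
      \<open>X\<close>, which \<open>I(2)\<close> replaces.\<close>
    unfolding compl
    unfolding I(2) J(2) card_transitions[OF I(1) J(1) \<open>J \<noteq> {}\<close>] deg_seq_eq[OF J(1) n] deg_seq_eq[OF K n]
    by (simp only:)
qed

end
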